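(* From a name of a harmonic function $u$, and names of $z_0\in\mathbb{C}$ and $R>0$ such that $\overline{D_R(z_0)}\subseteq\mathrm{dom}(u)$, one can uniformly compute a name of a harmonic conjugate of $u$ on $D_R(z_0)$. That is, one computes a harmonic $v$ on $D_R(z_0)$ such that $u+iv$ is analytic on $D_R(z_0)$.
   Context: Computability is in the sense of Type-Two Effectivity. $\hat{\mathbb{C}}=\mathbb{C}\cup\{\infty\}$, and $D_r(z)$ is the open disk of radius $r$ centered at $z$. The basic open sets are the open rectangles with rational vertex coordinates and the sets $\hat{\mathbb{C}}\setminus\overline{D_r(0)}$ with $r$ rational. Names: - A name of a point $z$ (or real number) is a list of all basic open sets containing it. - A name of a partial function $f$ is an oracle $X\subseteq\mathbb{N}$ together with a code of an oracle Turing machine with one-way output tape. With oracle $X$, this machine converts every name of every $z\in\mathrm{dom}(f)$ into a name of $f(z)$. - "Uniformly computable" means a single machine, given names of the data, writes a name of the output. Harmonic functions: - A real-valued function on a domain (open connected set) $D\subseteq\mathbb{C}$ is harmonic if it is $C^2$ and satisfies $u_{xx}+u_{yy}=0$. - If $\infty\in D$, $u$ is harmonic if it is harmonic on $D\setminus\{\infty\}$ and $z\mapsto u(1/z)$ is harmonic on some disk $D_R(0)$. *)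

theory Defs
  imports "HOL-Analysis.Analysis" "HOL-Library.Nat_Bijection"
begin

datatype rf = Zero | Succ | Proj nat | Comp rf "rf list" | Prim rf rf | Mn rf | Orc

inductive eval :: "rf \<Rightarrow> (nat \<Rightarrow> nat) \<Rightarrow> nat list \<Rightarrow> nat \<Rightarrow> bool" where
  ev_zero: "eval Zero g xs 0"
| ev_succ: "eval Succ g (x # xs) (Suc x)"
| ev_proj: "i < length xs \<Longrightarrow> eval (Proj i) g xs (xs ! i)"
| ev_comp: "length ys = length hs \<Longrightarrow> (\<forall>i<length hs. eval (hs ! i) g xs (ys ! i))
            \<Longrightarrow> eval f g ys z \<Longrightarrow> eval (Comp f hs) g xs z"
| ev_prim0: "eval f g xs y \<Longrightarrow> eval (Prim f h) g (0 # xs) y"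
| ev_primS: "eval (Prim f h) g (n # xs) y \<Longrightarrow> eval h g (y # n # xs) z
            \<Longrightarrow> eval (Prim f h) g (Suc n # xs) z"
| ev_mn: "eval f g (n # xs) 0 \<Longrightarrow> (\<forall>m<n. \<exists>y. y \<noteq> 0 \<and> eval f g (m # xs) y)
          \<Longrightarrow> eval (Mn f) g xs n"
| ev_orc: "eval Orc g (x # xs) (g x)"

primrec enc :: "rf \<Rightarrow> nat" where
  "enc Zero = prod_encode (0, 0)"
| "enc Succ = prod_encode (1, 0)"
| "enc (Proj i) = prod_encode (2, i)"
| "enc (Comp f hs) = prod_encode (3, prod_encode (enc f, list_encode (map enc hs)))"
| "enc (Prim f h) = prod_encode (4, prod_encode (enc f, enc h))"
| "enc (Mn f) = prod_encode (5, enc f)"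
| "enc Orc = prod_encode (6, 0)"

text \<open>The machine M with oracle g writes (on its one-way output tape) the infinite sequence q.\<close>
definition writes :: "rf \<Rightarrow> (nat \<Rightarrow> nat) \<Rightarrow> (nat \<Rightarrow> nat) \<Rightarrow> bool" where
  "writes M g q \<longleftrightarrow> (\<forall>n. eval M g [n] (q n))"

text \<open>None represents \<infinity>; Some z represents z \<in> \<complex>.\<close>
type_synonym csphere = "complex option"

definition qdec :: "nat \<Rightarrow> real" where
  "qdec n = (case prod_decode n of (a, b) \<Rightarrow> real_of_int (int_decode a) / real (b + 1))"

definition basic :: "nat \<Rightarrow> csphere set" where
  "basic n = (case prod_decode n of (t, m) \<Rightarrow>
     if t = 0 then
       (case prod_decode m of (a, m') \<Rightarrow> case prod_decode m' of (b, m'') \<Rightarrow>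
          case prod_decode m'' of (c, d) \<Rightarrow>
            Some ` box (Complex (qdec a) (qdec c)) (Complex (qdec b) (qdec d)))
     else {None} \<union> Some ` (- closure (ball 0 (qdec m))))"

definition rbasic :: "nat \<Rightarrow> real set" where
  "rbasic n = (case prod_decode n of (a, b) \<Rightarrow> {qdec a <..< qdec b})"

definition cname :: "csphere \<Rightarrow> (nat \<Rightarrow> nat) \<Rightarrow> bool" where
  "cname z p \<longleftrightarrow> range p = {n. z \<in> basic n}"

definition rname :: "real \<Rightarrow> (nat \<Rightarrow> nat) \<Rightarrow> bool" where
  "rname x p \<longleftrightarrow> range p = {n. x \<in> rbasic n}"

definition join2 :: "nat set \<Rightarrow> (nat \<Rightarrow> nat) \<Rightarrow> nat \<Rightarrow> nat" where
  "join2 X p n = (case prod_decode n of (i, m) \<Rightarrow> if i = 0 then (if m \<in> X then 1 else 0) else p m)"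

definition join3 :: "(nat \<Rightarrow> nat) \<Rightarrow> (nat \<Rightarrow> nat) \<Rightarrow> (nat \<Rightarrow> nat) \<Rightarrow> nat \<Rightarrow> nat" where
  "join3 p1 p2 p3 n = (case prod_decode n of (i, m) \<Rightarrow>
      if i = 0 then p1 m else if i = 1 then p2 m else p3 m)"

definition realizes :: "rf \<Rightarrow> nat set \<Rightarrow> csphere set \<Rightarrow> (csphere \<Rightarrow> real) \<Rightarrow> bool" where
  "realizes e X D f \<longleftrightarrow>
     (\<forall>z\<in>D. \<forall>p. cname z p \<longrightarrow> (\<exists>q. writes e (join2 X p) q \<and> rname (f z) q))"

text \<open>A name of the partial function (D, f), as an element of Baire space:
  entry 0 is the code of the machine, entry n+1 the characteristic value of n in the oracle.\<close>
definition fname :: "csphere set \<Rightarrow> (csphere \<Rightarrow> real) \<Rightarrow> (nat \<Rightarrow> nat) \<Rightarrow> bool" where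
  "fname D f p \<longleftrightarrow> (\<exists>e. p 0 = enc e \<and> realizes e {n. p (Suc n) \<noteq> 0} D f)"

definition open_cs :: "csphere set \<Rightarrow> bool" where
  "open_cs S \<longleftrightarrow> open {z. Some z \<in> S} \<and> (None \<in> S \<longrightarrow> (\<exists>r. \<forall>z. norm z > r \<longrightarrow> Some z \<in> S))"

definition connected_cs :: "csphere set \<Rightarrow> bool" where
  "connected_cs D \<longleftrightarrow> \<not> (\<exists>A B. open_cs A \<and> open_cs B \<and> D \<subseteq> A \<union> B \<and> A \<inter> B \<inter> D = {}
                              \<and> A \<inter> D \<noteq> {} \<and> B \<inter> D \<noteq> {})"

definition domain_cs :: "csphere set \<Rightarrow> bool" where
  "domain_cs D \<longleftrightarrow> open_cs D \<and> connected_cs D"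

definition harmonic_on :: "complex set \<Rightarrow> (complex \<Rightarrow> real) \<Rightarrow> bool" where
  "harmonic_on D u \<longleftrightarrow> open D \<and>
    (\<exists>ux uy uxx uxy uyx uyy.
       (\<forall>z\<in>D. (u has_derivative (\<lambda>h. ux z * Re h + uy z * Im h)) (at z)) \<and>
       (\<forall>z\<in>D. (ux has_derivative (\<lambda>h. uxx z * Re h + uxy z * Im h)) (at z)) \<and>
       (\<forall>z\<in>D. (uy has_derivative (\<lambda>h. uyx z * Re h + uyy z * Im h)) (at z)) \<and>
       continuous_on D uxx \<and> continuous_on D uxy \<and> continuous_on D uyx \<and> continuous_on D uyy \<and>
       (\<forall>z\<in>D. uxx z + uyy z = 0))"

definition harmonic_cs :: "csphere set \<Rightarrow> (csphere \<Rightarrow> real) \<Rightarrow> bool" where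
  "harmonic_cs D u \<longleftrightarrow> harmonic_on {z. Some z \<in> D} (\<lambda>z. u (Some z)) \<and>
     (None \<in> D \<longrightarrow> (\<exists>R>0. harmonic_on (ball 0 R)
                             (\<lambda>w. u (if w = 0 then None else Some (1 / w)))))"

end

theory Submission
  imports Defs "HOL-Complex_Analysis.Complex_Analysis"
begin

text \<open>
  Let \<open>f = u + i v\<close> be holomorphic on the disk with \<open>v z0 = 0\<close>. If \<open>\<bar>u\<bar> < M\<close> on the disk of radius \<open>r\<close>
  around \<open>w\<close>, then \<open>v (w + h) - v w = u w - u (w + i h) + O(M h\<^sup>2 / r\<^sup>2)\<close>. Summing along a chain of
  \<open>N\<close> rational points near the segment from \<open>z0\<close> to \<open>z\<close> determines \<open>v z\<close> up to \<open>O(1/N)\<close>. All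
  hypotheses of such an estimate have finite certificates: a machine for \<open>u\<close> that has read
  finitely many basic sets and outputs an interval has certified a bound of \<open>u\<close> on their
  intersection. Hence the rational intervals around \<open>v z\<close> are uniformly enumerable from the name
  of \<open>z\<close> and the data. The name of \<open>v\<close> is the code of one fixed enumerating machine together with
  the graph of the data as its oracle, so the uniform transformation itself is trivial.
\<close>

section \<open>Functions computable with an oracle\<close>

text \<open>The obstacle is that \<open>u\<close> is known only through the code of a machine that
  is reliable only on names of points of its domain. So the code has to be simulated, and every
  square on which \<open>u\<close> is queried for a bound needs a certificate that it lies in the
  disk (\<open>in_disc\<close>). No derivative of \<open>u\<close> and no integral is computed: the
  increments of \<open>f\<close> along \<open>h\<close> and \<open>\<i> * h\<close> have linear
  terms differing by the factor \<open>\<i>\<close>, so the imaginary part of one is read off from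
  the real part of the other, with an error quadratic in \<open>h\<close>. The quadratic order is
  essential, since errors of first order would not shrink when summed over the chain. Simulation and
  chain are both finite derivations under a monotone enumerable rule, so \<open>ce_derivable\<close>
  serves for both. Moduli need not be computed either: radii, bounds and the length of the chain are
  found by search, and completeness only asserts that some choice succeeds, by compactness of the
  segment. The data enter as a graph because the oracle inside a name of a function is a set of
  naturals, while the data are functions.\<close>

definition computes :: "rf \<Rightarrow> nat \<Rightarrow> ((nat \<Rightarrow> nat) \<Rightarrow> nat list \<Rightarrow> nat) \<Rightarrow> bool" where
  "computes e k F \<longleftrightarrow> (\<forall>g xs. length xs = k \<longrightarrow> eval e g xs (F g xs))"

text \<open>The program is chosen before the oracle, so membership means an algorithm uniform in all
  oracles. Totality in every oracle keeps the closure rules free of domain conditions.\<close>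

definition rcn :: "nat \<Rightarrow> ((nat \<Rightarrow> nat) \<Rightarrow> nat list \<Rightarrow> nat) \<Rightarrow> bool" where
  "rcn k F \<longleftrightarrow> (\<exists>e. computes e k F)"

lemma rcn_proj: "i < k \<Longrightarrow> rcn k (\<lambda>g xs. xs ! i)"
  unfolding rcn_def computes_def using ev_proj by blast

lemma rcn_comp:
  assumes "rcn (length Gs) F" "\<And>G. G \<in> set Gs \<Longrightarrow> rcn k G"
  shows "rcn k (\<lambda>g xs. F g (map (\<lambda>G. G g xs) Gs))"
proof -
  from assms(1) obtain e where e: "computes e (length Gs) F" unfolding rcn_def by blast
  have "\<forall>G\<in>set Gs. \<exists>e. computes e k G" using assms(2) unfolding rcn_def by blast
  then obtain E where E: "\<forall>G\<in>set Gs. computes (E G) k G" by metis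
  have "computes (Comp e (map E Gs)) k (\<lambda>g xs. F g (map (\<lambda>G. G g xs) Gs))"
    unfolding computes_def
  proof (intro allI impI)
    fix g and xs :: "nat list" assume "length xs = k"
    then show "eval (Comp e (map E Gs)) g xs (F g (map (\<lambda>G. G g xs) Gs))"
      by (intro ev_comp[where ys = "map (\<lambda>G. G g xs) Gs"])
        (use e E in \<open>auto simp: computes_def\<close>)
  qed
  then show ?thesis unfolding rcn_def by blast
qed

lemma rcn_comp1: "rcn 1 F \<Longrightarrow> rcn k G \<Longrightarrow> rcn k (\<lambda>g xs. F g [G g xs])"
  using rcn_comp[of "[G]" F k] by simp

lemma rcn_comp2: "rcn 2 F \<Longrightarrow> rcn k G \<Longrightarrow> rcn k H \<Longrightarrow> rcn k (\<lambda>g xs. F g [G g xs, H g xs])"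
  using rcn_comp[of "[G, H]" F k] by (auto simp: numeral_2_eq_2)

lemma rcn_Suc: "rcn k G \<Longrightarrow> rcn k (\<lambda>g xs. Suc (G g xs))"
proof -
  have "computes Succ 1 (\<lambda>g xs. Suc (hd xs))"
    unfolding computes_def by (auto simp: length_Suc_conv intro: ev_succ)
  then have "rcn 1 (\<lambda>g xs. Suc (hd xs))" unfolding rcn_def by blast
  from rcn_comp1[OF this, of k G] show "rcn k G \<Longrightarrow> ?thesis" by simp
qed

lemma rcn_oracle: "rcn k G \<Longrightarrow> rcn k (\<lambda>g xs. g (G g xs))"
proof -
  have "computes Orc 1 (\<lambda>g xs. g (hd xs))"
    unfolding computes_def by (auto simp: length_Suc_conv intro: ev_orc)
  then have "rcn 1 (\<lambda>g xs. g (hd xs))" unfolding rcn_def by blast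
  from rcn_comp1[OF this, of k G] show "rcn k G \<Longrightarrow> ?thesis" by simp
qed

lemma rcn_const: "rcn k (\<lambda>g xs. c)"
proof (induction c)
  case 0
  have "computes Zero k (\<lambda>g xs. 0)" unfolding computes_def by (auto intro: ev_zero)
  then show ?case unfolding rcn_def by blast
next
  case (Suc c)
  then show ?case by (rule rcn_Suc)
qed

lemma rcn_rec:
  assumes B: "rcn k B" and S: "rcn (Suc (Suc k)) S" and N: "rcn k N"
  shows "rcn k (\<lambda>g xs. rec_nat (B g xs) (\<lambda>n r. S g (r # n # xs)) (N g xs))"
proof -
  obtain b s where b: "computes b k B" and s: "computes s (Suc (Suc k)) S"
    using B S unfolding rcn_def by blast
  have *: "eval (Prim b s) g (n # xs) (rec_nat (B g xs) (\<lambda>n r. S g (r # n # xs)) n)"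
    if "length xs = k" for g n xs
  proof (induction n)
    case 0 then show ?case using b that unfolding computes_def by (auto intro: ev_prim0)
  next
    case (Suc n)
    show ?case
      by (rule ev_primS[OF Suc]) (use s that in \<open>auto simp: computes_def\<close>)
  qed
  have "computes (Prim b s) (Suc k)
     (\<lambda>g xs. rec_nat (B g (tl xs)) (\<lambda>n r. S g (r # n # tl xs)) (hd xs))"
    unfolding computes_def by (auto simp: length_Suc_conv *)
  then have P: "rcn (Suc k) (\<lambda>g xs. rec_nat (B g (tl xs)) (\<lambda>n r. S g (r # n # tl xs)) (hd xs))"
    unfolding rcn_def by blast
  \<comment> \<open>\<open>Prim\<close> recurses on the head of its argument list; substituting
    \<open>N\<close> followed by all projections makes the recursion depth a function of
    \<open>xs\<close>.\<close>
  let ?Gs = "N # map (\<lambda>i g xs. xs ! i) [0..<k]"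
  have "rcn k (\<lambda>g xs. (\<lambda>g xs. rec_nat (B g (tl xs)) (\<lambda>n r. S g (r # n # tl xs)) (hd xs)) g
            (map (\<lambda>G. G g xs) ?Gs))"
    by (rule rcn_comp) (use P N in \<open>auto intro: rcn_proj\<close>)
  moreover have "map (\<lambda>i. xs ! i) [0..<k] = xs" if "length xs = k" for xs :: "nat list"
    using that map_nth by blast
  ultimately show ?thesis
    unfolding rcn_def computes_def by (auto simp: comp_def)
qed

lemma rcn_least:
  assumes F: "rcn (Suc k) F" and ex: "\<And>g xs. length xs = k \<Longrightarrow> \<exists>n. F g (n # xs) = 0"
  shows "rcn k (\<lambda>g xs. LEAST n. F g (n # xs) = 0)"
proof -
  obtain f where f: "computes f (Suc k) F" using F unfolding rcn_def by blast
  have "computes (Mn f) k (\<lambda>g xs. LEAST n. F g (n # xs) = 0)"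
    unfolding computes_def
  proof (intro allI impI)
    fix g and xs :: "nat list" assume l: "length xs = k"
    let ?n = "LEAST n. F g (n # xs) = 0"
    have 0: "F g (?n # xs) = 0" using ex[OF l] by (rule LeastI_ex)
    have ev: "eval f g (m # xs) (F g (m # xs))" for m
      using f l unfolding computes_def by auto
    show "eval (Mn f) g xs ?n"
      by (rule ev_mn) (use 0 ev[of ?n] ev not_less_Least in \<open>fastforce+\<close>)
  qed
  then show ?thesis unfolding rcn_def by blast
qed

text \<open>From here on several arguments are packed into one number by Cantor pairing, so that the
  closure rules apply by \<open>intro\<close> without bookkeeping of argument lists.\<close>

definition rc :: "((nat \<Rightarrow> nat) \<Rightarrow> nat \<Rightarrow> nat) \<Rightarrow> bool" where
  "rc F \<longleftrightarrow> (\<exists>e. \<forall>g x. eval e g [x] (F g x))"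

lemma rc_iff: "rc F \<longleftrightarrow> rcn 1 (\<lambda>g xs. F g (xs ! 0))"
proof -
  have "(\<forall>x. eval e g [x] (F g x)) \<longleftrightarrow> (\<forall>xs. length xs = 1 \<longrightarrow> eval e g xs (F g (xs ! 0)))" for e g
    by (auto simp: length_Suc_conv)
  then show ?thesis unfolding rc_def rcn_def computes_def by simp
qed

definition rc2 :: "(nat \<Rightarrow> nat \<Rightarrow> nat) \<Rightarrow> bool" where
  "rc2 f \<longleftrightarrow> rcn 2 (\<lambda>g xs. f (xs ! 0) (xs ! 1))"

lemma rcn_app2: "rc2 f \<Longrightarrow> rcn k G \<Longrightarrow> rcn k H \<Longrightarrow> rcn k (\<lambda>g xs. f (G g xs) (H g xs))"
  unfolding rc2_def by (drule rcn_comp2) auto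

lemma rc_app2: "rc2 f \<Longrightarrow> rc G \<Longrightarrow> rc H \<Longrightarrow> rc (\<lambda>g x. f (G g x) (H g x))"
  unfolding rc_iff by (rule rcn_app2)

lemma rc2_add: "rc2 (+)"
proof -
  have "rcn 2 (\<lambda>g xs. rec_nat (xs ! 0) (\<lambda>n r. (\<lambda>g xs. Suc (xs ! 0)) g (r # n # xs)) (xs ! 1))"
    by (intro rcn_rec rcn_Suc rcn_proj) auto
  moreover have "rec_nat a (\<lambda>n r. Suc r) b = a + b" for a b :: nat by (induction b) auto
  ultimately show ?thesis by (simp add: rc2_def)
qed

lemma rc2_mult: "rc2 (*)"
proof -
  have "rcn 2 (\<lambda>g xs. rec_nat 0 (\<lambda>n r. (\<lambda>g xs. xs ! 0 + xs ! 2) g (r # n # xs)) (xs ! 1))"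
    by (intro rcn_rec rcn_app2[OF rc2_add] rcn_proj rcn_const) auto
  moreover have "rec_nat 0 (\<lambda>n r. r + a) b = a * b" for a b :: nat by (induction b) auto
  ultimately show ?thesis by (simp add: rc2_def)
qed

lemma rcn_pred: "rcn k G \<Longrightarrow> rcn k (\<lambda>g xs. G g xs - 1)"
proof -
  have "rcn 1 (\<lambda>g xs. rec_nat 0 (\<lambda>n r. (\<lambda>g xs. xs ! 1) g (r # n # xs)) (xs ! 0))"
    by (intro rcn_rec rcn_proj rcn_const) auto
  moreover have "rec_nat 0 (\<lambda>n r. n) b = b - 1" for b :: nat by (cases b) auto
  ultimately have "rcn 1 (\<lambda>g xs. xs ! 0 - 1)" by simp
  from rcn_comp1[OF this, of k G] show "rcn k G \<Longrightarrow> ?thesis" by simp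
qed

lemma rc2_diff: "rc2 (-)"
proof -
  have "rcn 2 (\<lambda>g xs. rec_nat (xs ! 0) (\<lambda>n r. (\<lambda>g xs. xs ! 0 - 1) g (r # n # xs)) (xs ! 1))"
    by (intro rcn_rec rcn_pred rcn_proj) auto
  moreover have "rec_nat a (\<lambda>n r. r - 1) b = a - b" for a b :: nat by (induction b) auto
  ultimately show ?thesis by (simp add: rc2_def)
qed

section \<open>Cantor pairing and its inverses\<close>

abbreviation pr :: "nat \<Rightarrow> nat \<Rightarrow> nat" where "pr a b \<equiv> prod_encode (a, b)"
definition p1 :: "nat \<Rightarrow> nat" where "p1 n = fst (prod_decode n)"
definition p2 :: "nat \<Rightarrow> nat" where "p2 n = snd (prod_decode n)"

lemma p_pr [simp]: "p1 (pr a b) = a" "p2 (pr a b) = b" "pr (p1 n) (p2 n) = n"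
  by (auto simp: p1_def p2_def)

lemma ex_pr: "\<exists>a b. n = pr a b"
  by (metis p_pr(3))

lemma rcn_triangle: "rcn k G \<Longrightarrow> rcn k (\<lambda>g xs. triangle (G g xs))"
proof -
  have "rcn 1 (\<lambda>g xs. rec_nat 0 (\<lambda>n r. (\<lambda>g xs. xs ! 0 + Suc (xs ! 1)) g (r # n # xs)) (xs ! 0))"
    by (intro rcn_rec rcn_app2[OF rc2_add] rcn_Suc rcn_proj rcn_const) auto
  moreover have "rec_nat 0 (\<lambda>n r. r + Suc n) b = triangle b" for b :: nat by (induction b) auto
  ultimately have "rcn 1 (\<lambda>g xs. triangle (xs ! 0))" by simp
  from rcn_comp1[OF this, of k G] show "rcn k G \<Longrightarrow> ?thesis" by simp
qed

lemma rc2_pr: "rc2 pr"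
  unfolding prod_encode_def rc2_def using
    rcn_app2[OF rc2_add rcn_triangle[OF rcn_app2[OF rc2_add rcn_proj[of 0 2] rcn_proj[of 1 2]]] rcn_proj[of 0 2]]
  by simp

lemma triangle_mono: "a \<le> b \<Longrightarrow> triangle a \<le> triangle b"
  by (induction b) (auto simp: le_Suc_eq)

text \<open>The code of \<open>(a, b)\<close> is \<open>triangle (a + b) + a\<close>, which lies
  below \<open>triangle (a + b + 1)\<close>. Truncated subtraction turns the strict inequality
  \<open>n < triangle (Suc s)\<close> into an equation with 0, the form that minimisation
  accepts.\<close>

lemma diagonal_eq_Least: "p1 n + p2 n = (LEAST s. Suc n - triangle (Suc s) = 0)"
proof -
  obtain a b where n: "n = pr a b" using ex_pr by blast
  have "(LEAST s. Suc n - triangle (Suc s) = 0) = a + b"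
  proof (rule Least_equality)
    show "Suc n - triangle (Suc (a + b)) = 0" by (simp add: n prod_encode_def)
  next
    fix s assume "Suc n - triangle (Suc s) = 0"
    then have "n < triangle (Suc s)" by simp
    show "a + b \<le> s"
    proof (rule ccontr)
      assume "\<not> a + b \<le> s"
      then have "triangle (Suc s) \<le> triangle (a + b)" by (intro triangle_mono) auto
      with \<open>n < _\<close> show False by (simp add: n prod_encode_def)
    qed
  qed
  then show ?thesis by (simp add: n)
qed

lemma le_triangle: "n \<le> triangle n"
  by (induction n) auto

lemma rcn_p12: "rcn 1 (\<lambda>g xs. p1 (xs ! 0)) \<and> rcn 1 (\<lambda>g xs. p2 (xs ! 0))"
proof -
  have "rcn 1 (\<lambda>g xs. LEAST s. (\<lambda>g xs. Suc (xs ! 1) - triangle (Suc (xs ! 0))) g (s # xs) = 0)"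
  proof (rule rcn_least)
    show "rcn (Suc 1) (\<lambda>g xs. Suc (xs ! 1) - triangle (Suc (xs ! 0)))"
      by (intro rcn_app2[OF rc2_diff] rcn_Suc rcn_triangle rcn_proj) auto
    show "\<exists>n. Suc ((n # xs) ! 1) - triangle (Suc ((n # xs) ! 0)) = 0" for xs :: "nat list"
      by (rule exI[of _ "xs ! 0"]) (use le_triangle[of "xs ! 0"] in simp)
  qed
  then have s: "rcn 1 (\<lambda>g xs. p1 (xs ! 0) + p2 (xs ! 0))"
    unfolding diagonal_eq_Least by simp
  have 1: "p1 n = n - triangle (p1 n + p2 n)" for n
    using ex_pr[of n] by (auto simp: prod_encode_def[symmetric]) (simp add: prod_encode_def)
  have r1: "rcn 1 (\<lambda>g xs. p1 (xs ! 0))"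
    by (subst 1) (intro rcn_app2[OF rc2_diff] rcn_triangle s rcn_proj, simp)
  have 2: "p2 n = (p1 n + p2 n) - p1 n" for n by simp
  have "rcn 1 (\<lambda>g xs. p2 (xs ! 0))"
    by (subst 2) (intro rcn_app2[OF rc2_diff] s r1)
  with r1 show ?thesis by blast
qed

lemma rc_p1: "rc G \<Longrightarrow> rc (\<lambda>g x. p1 (G g x))"
  and rc_p2: "rc G \<Longrightarrow> rc (\<lambda>g x. p2 (G g x))"
  using rcn_comp1[of "\<lambda>g xs. p1 (xs ! 0)" 1] rcn_comp1[of "\<lambda>g xs. p2 (xs ! 0)" 1] rcn_p12
  unfolding rc_iff by auto

lemma rc_id: "rc (\<lambda>g x. x)"
  unfolding rc_iff by (rule rcn_proj) simp

lemma rc_const: "rc (\<lambda>g x. c)"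
  unfolding rc_iff by (rule rcn_const)

lemma rc_Suc: "rc G \<Longrightarrow> rc (\<lambda>g x. Suc (G g x))"
  unfolding rc_iff by (rule rcn_Suc)

lemma rc_oracle: "rc G \<Longrightarrow> rc (\<lambda>g x. g (G g x))"
  unfolding rc_iff by (rule rcn_oracle)

lemmas rc_add = rc_app2[OF rc2_add] and rc_mult = rc_app2[OF rc2_mult]
  and rc_diff = rc_app2[OF rc2_diff] and rc_pr = rc_app2[OF rc2_pr]

lemma rc_comp: "rc F \<Longrightarrow> rc G \<Longrightarrow> rc (\<lambda>g x. F g (G g x))"
  unfolding rc_iff by (drule rcn_comp1) auto

lemma rc_rec:
  assumes "rc B" "rc N" "rc (\<lambda>g w. S g (p1 w) (p1 (p2 w)) (p2 (p2 w)))"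
  shows "rc (\<lambda>g x. rec_nat (B g x) (S g x) (N g x))"
proof -
  let ?T = "\<lambda>g w. S g (p1 w) (p1 (p2 w)) (p2 (p2 w))"
  have "rcn (Suc (Suc 1)) (\<lambda>g xs. (\<lambda>g xs. ?T g (xs ! 0)) g [pr (xs ! 2) (pr (xs ! 1) (xs ! 0))])"
    by (rule rcn_comp1) (use assms(3) in \<open>auto simp: rc_iff intro!: rcn_app2[OF rc2_pr] rcn_proj\<close>)
  then have "rcn 1 (\<lambda>g xs. rec_nat (B g (xs ! 0)) (\<lambda>n r. (\<lambda>g xs. (\<lambda>g xs. ?T g (xs ! 0)) g [pr (xs ! 2) (pr (xs ! 1) (xs ! 0))]) g (r # n # xs)) (N g (xs ! 0)))"
    by (intro rcn_rec) (use assms in \<open>auto simp: rc_iff\<close>)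
  then show ?thesis unfolding rc_iff by simp
qed

lemma rc_least:
  assumes F: "rc (\<lambda>g w. F g (p1 w) (p2 w))" and ex: "\<And>g x. \<exists>n. F g x n = 0"
  shows "rc (\<lambda>g x. LEAST n. F g x n = 0)"
proof -
  have "rcn (Suc 1) (\<lambda>g xs. (\<lambda>g xs. F g (p1 (xs ! 0)) (p2 (xs ! 0))) g [pr (xs ! 1) (xs ! 0)])"
    by (rule rcn_comp1) (use F in \<open>auto simp: rc_iff intro!: rcn_app2[OF rc2_pr] rcn_proj\<close>)
  from rcn_least[OF this] ex show ?thesis unfolding rc_iff by simp
qed

named_theorems rc_intros
declare rc_id [rc_intros] rc_const [rc_intros] rc_Suc [rc_intros] rc_oracle [rc_intros]
  rc_add [rc_intros] rc_mult [rc_intros] rc_diff [rc_intros] rc_pr [rc_intros]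
  rc_p1 [rc_intros] rc_p2 [rc_intros]

lemma rc_if0 [rc_intros]:
  assumes "rc A" "rc B" "rc C"
  shows "rc (\<lambda>g x. if A g x = 0 then B g x else C g x)"
proof -
  \<comment> \<open>Truncated subtraction makes \<open>1 - A g x\<close> the indicator of
    \<open>A g x = 0\<close>.\<close>
  have "rc (\<lambda>g x. (1 - A g x) * B g x + (1 - (1 - A g x)) * C g x)"
    by (intro rc_intros assms)
  moreover have "(\<lambda>g x. (1 - A g x) * B g x + (1 - (1 - A g x)) * C g x)
    = (\<lambda>g x. if A g x = 0 then B g x else C g x)" by (auto simp: fun_eq_iff)
  ultimately show ?thesis by metis
qed

lemma rc_div2 [rc_intros]: "rc G \<Longrightarrow> rc (\<lambda>g x. G g x div 2)"
proof -
  have "rc (\<lambda>g x. LEAST k. x - (2 * k + 1) = 0)"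
    by (rule rc_least, intro rc_intros, rule_tac x=x in exI) simp
  moreover have "(LEAST k. x - (2 * k + 1) = 0) = x div 2" for x :: nat
    by (rule Least_equality) auto
  ultimately have "rc (\<lambda>g x. x div 2)" by simp
  from rc_comp[OF this, of G] show "rc G \<Longrightarrow> ?thesis" by simp
qed

section \<open>Codes of finite lists\<close>

definition ldrop :: "nat \<Rightarrow> nat \<Rightarrow> nat" where
  "ldrop i c = list_encode (drop i (list_decode c))"
definition llen :: "nat \<Rightarrow> nat" where
  "llen c = length (list_decode c)"
definition lnth :: "nat \<Rightarrow> nat \<Rightarrow> nat" where
  "lnth c i = (if i < llen c then list_decode c ! i else 0)"

lemma list_encode_eq_0 [simp]: "list_encode l = 0 \<longleftrightarrow> l = []"
  by (cases l) auto

text \<open>A nonempty list is coded by \<open>Suc (pr a r)\<close> with \<open>r\<close> the code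
  of its tail, so suffixes arise by iteration. Length (the first empty suffix) and entries (heads of
  suffixes) then reduce to \<open>ldrop\<close>.\<close>

lemma ldrop_eq_rec: "ldrop i c = rec_nat c (\<lambda>n r. if r = 0 then 0 else p2 (r - 1)) i"
proof (induction i)
  case (Suc i)
  have "ldrop (Suc i) c = (if ldrop i c = 0 then 0 else p2 (ldrop i c - 1))"
    by (cases "drop i (list_decode c)")
      (auto simp: ldrop_def drop_Suc tl_drop[symmetric])
  then show ?case by (simp add: Suc)
qed (simp add: ldrop_def)

lemma rc_ldrop [rc_intros]: "rc G \<Longrightarrow> rc H \<Longrightarrow> rc (\<lambda>g x. ldrop (G g x) (H g x))"
  unfolding ldrop_eq_rec by (intro rc_rec rc_intros)

lemma rc_llen [rc_intros]: "rc G \<Longrightarrow> rc (\<lambda>g x. llen (G g x))"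
proof -
  have *: "ldrop i c = 0 \<longleftrightarrow> llen c \<le> i" for i c
    by (auto simp: ldrop_def llen_def)
  have "rc (\<lambda>g x. LEAST k. ldrop k x = 0)"
    by (rule rc_least, intro rc_intros) (auto simp: *)
  moreover have "(LEAST k. ldrop k x = 0) = llen x" for x :: nat
    by (rule Least_equality) (auto simp: *)
  ultimately have "rc (\<lambda>g x. llen x)" by simp
  from rc_comp[OF this, of G] show "rc G \<Longrightarrow> ?thesis" by simp
qed

lemma lnth_eq: "lnth c i = (if ldrop i c = 0 then 0 else p1 (ldrop i c - 1))"
  by (cases "drop i (list_decode c)")
    (auto simp: lnth_def ldrop_def llen_def hd_drop_conv_nth[symmetric])

lemma rc_lnth [rc_intros]: "rc G \<Longrightarrow> rc H \<Longrightarrow> rc (\<lambda>g x. lnth (G g x) (H g x))"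
  unfolding lnth_eq by (intro rc_intros)

section \<open>Uniformly enumerable predicates\<close>

text \<open>Relativised Sigma-1 normal form with one search function for all oracles. Negation is
  available only for decidable conditions, so all certificates below are built positively.\<close>

definition ce :: "((nat \<Rightarrow> nat) \<Rightarrow> nat \<Rightarrow> bool) \<Rightarrow> bool" where
  "ce P \<longleftrightarrow> (\<exists>F. rc F \<and> (\<forall>g x. P g x \<longleftrightarrow> (\<exists>t. F g (pr x t) = 0)))"

named_theorems ce_intros

lemma ceI: "rc (\<lambda>g w. F g (p1 w) (p2 w)) \<Longrightarrow> (\<And>g x. P g x \<longleftrightarrow> (\<exists>t. F g x t = 0)) \<Longrightarrow> ce P"
  unfolding ce_def by (rule exI[of _ "\<lambda>g w. F g (p1 w) (p2 w)"]) simp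

lemma ceE:
  assumes "ce P"
  obtains F where "rc F" "\<And>g x. P g x \<longleftrightarrow> (\<exists>t. F g (pr x t) = 0)"
  using assms unfolding ce_def by blast

lemma rc_at_p1: "rc G \<Longrightarrow> rc (\<lambda>g w. G g (p1 w))"
  by (rule rc_comp[OF _ rc_p1[OF rc_id]])

lemma ce_le [ce_intros]: "rc G \<Longrightarrow> rc H \<Longrightarrow> ce (\<lambda>g x. G g x \<le> H g x)"
  by (rule ceI[where F = "\<lambda>g x t. G g x - H g x"]) (intro rc_intros rc_at_p1, auto)

lemma ce_less [ce_intros]: "rc G \<Longrightarrow> rc H \<Longrightarrow> ce (\<lambda>g x. G g x < H g x)"
  by (rule ceI[where F = "\<lambda>g x t. Suc (G g x) - H g x"]) (intro rc_intros rc_at_p1, auto)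

lemma ce_eq [ce_intros]: "rc G \<Longrightarrow> rc H \<Longrightarrow> ce (\<lambda>g x. G g x = H g x)"
  by (rule ceI[where F = "\<lambda>g x t. (G g x - H g x) + (H g x - G g x)"]) (intro rc_intros rc_at_p1, auto)

lemma ce_neq [ce_intros]: "rc G \<Longrightarrow> rc H \<Longrightarrow> ce (\<lambda>g x. G g x \<noteq> H g x)"
  by (rule ceI[where F = "\<lambda>g x t. 1 - ((G g x - H g x) + (H g x - G g x))"]) (intro rc_intros rc_at_p1, auto)

lemma ce_conj [ce_intros]: "ce P \<Longrightarrow> ce Q \<Longrightarrow> ce (\<lambda>g x. P g x \<and> Q g x)"
proof (elim ceE)
  fix F G assume F: "rc F" "\<And>g x. P g x \<longleftrightarrow> (\<exists>t. F g (pr x t) = 0)"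
    and G: "rc G" "\<And>g x. Q g x \<longleftrightarrow> (\<exists>t. G g (pr x t) = 0)"
  show ?thesis
  proof (rule ceI[where F = "\<lambda>g x t. F g (pr x (p1 t)) + G g (pr x (p2 t))"])
    show "rc (\<lambda>g w. F g (pr (p1 w) (p1 (p2 w))) + G g (pr (p1 w) (p2 (p2 w))))"
      by (intro rc_intros rc_comp[OF F(1)] rc_comp[OF G(1)])
    show "(P g x \<and> Q g x) = (\<exists>t. F g (pr x (p1 t)) + G g (pr x (p2 t)) = 0)" for g x
      unfolding F(2) G(2) by (metis add_is_0 p_pr(1,2))
  qed
qed

lemma ce_ex [ce_intros]:
  assumes "ce (\<lambda>g w. P g (p1 w) (p2 w))"
  shows "ce (\<lambda>g x. \<exists>y. P g x y)"
proof -
  obtain F where F: "rc F" "\<And>g w. P g (p1 w) (p2 w) \<longleftrightarrow> (\<exists>t. F g (pr w t) = 0)"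
    by (rule ceE[OF assms], rule that)
  show ?thesis
  proof (rule ceI[where F = "\<lambda>g x t. F g (pr (pr x (p1 t)) (p2 t))"])
    show "rc (\<lambda>g w. F g (pr (pr (p1 w) (p1 (p2 w))) (p2 (p2 w))))"
      by (intro rc_intros rc_comp[OF F(1)])
    show "(\<exists>y. P g x y) = (\<exists>t. F g (pr (pr x (p1 t)) (p2 t)) = 0)" for g x
      using F(2)[of g "pr x _"] by (simp) (metis p_pr(1,2))
  qed
qed

lemma ce_disj [ce_intros]: "ce P \<Longrightarrow> ce Q \<Longrightarrow> ce (\<lambda>g x. P g x \<or> Q g x)"
proof (elim ceE)
  fix F G assume F: "rc F" "\<And>g x. P g x \<longleftrightarrow> (\<exists>t. F g (pr x t) = 0)"
    and G: "rc G" "\<And>g x. Q g x \<longleftrightarrow> (\<exists>t. G g (pr x t) = 0)"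
  show ?thesis
  proof (rule ceI[where F = "\<lambda>g x t. F g (pr x t) * G g (pr x t)"])
    show "rc (\<lambda>g w. F g (pr (p1 w) (p2 w)) * G g (pr (p1 w) (p2 w)))"
      by (intro rc_intros rc_comp[OF F(1)] rc_comp[OF G(1)])
    show "(P g x \<or> Q g x) = (\<exists>t. F g (pr x t) * G g (pr x t) = 0)" for g x
      unfolding F(2) G(2) by auto
  qed
qed

text \<open>A bounded existential quantifier is a product: it vanishes exactly when one of its
  factors does.\<close>

lemma rc_bex:
  assumes "rc (\<lambda>g w. F g (p1 w) (p2 w))" "rc N"
  shows "\<exists>H. rc H \<and> (\<forall>g x. H g x = 0 \<longleftrightarrow> (\<exists>i<N g x. F g x i = (0::nat)))"
proof (intro exI conjI allI)
  show "rc (\<lambda>g x. rec_nat 1 (\<lambda>n r. F g x n * r) (N g x))"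
  proof (intro rc_rec rc_intros assms(2))
    have "rc (\<lambda>g w. (\<lambda>g w. F g (p1 w) (p2 w)) g (pr (p1 w) (p1 (p2 w))))"
      by (intro rc_comp[OF assms(1)] rc_intros)
    then show "rc (\<lambda>g w. F g (p1 w) (p1 (p2 w)))" by simp
  qed
  show "rec_nat 1 (\<lambda>n r. F g x n * r) (N g x) = 0 \<longleftrightarrow> (\<exists>i<N g x. F g x i = 0)" for g x
  proof -
    have "rec_nat 1 (\<lambda>n r. F g x n * r) m = 0 \<longleftrightarrow> (\<exists>i<m. F g x i = 0)" for m
      by (induction m) (auto simp: less_Suc_eq)
    then show ?thesis .
  qed
qed

lemma rc_ball:
  assumes "rc (\<lambda>g w. F g (p1 w) (p2 w))" "rc N"
  shows "\<exists>H. rc H \<and> (\<forall>g x. H g x = 0 \<longleftrightarrow> (\<forall>i<N g x. F g x i = (0::nat)))"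
proof -
  have "rc (\<lambda>g w. 1 - F g (p1 w) (p2 w))" by (intro rc_intros assms)
  from rc_bex[of "\<lambda>g x i. 1 - F g x i", OF this assms(2)] obtain H where
    H: "rc H" "\<And>g x. H g x = 0 \<longleftrightarrow> (\<exists>i<N g x. 1 - F g x i = 0)" by auto
  show ?thesis
    by (rule exI[of _ "\<lambda>g x. 1 - H g x"], rule conjI, intro rc_intros H)
      (auto simp: H(2) not_less_eq_eq[symmetric] Suc_le_eq)
qed

text \<open>Finitely many witnesses have a common bound \<open>T\<close>, so one unbounded search
  for \<open>T\<close> can be moved outside; what remains is a bounded search for each
  \<open>i\<close> and hence decidable.\<close>

lemma ce_all_less [ce_intros]:
  assumes "rc N" "ce (\<lambda>g w. P g (p1 w) (p2 w))"
  shows "ce (\<lambda>g x. \<forall>i<N g x. P g x i)"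
proof -
  obtain F where F: "rc F" "\<And>g w. P g (p1 w) (p2 w) \<longleftrightarrow> (\<exists>t. F g (pr w t) = 0)"
    by (rule ceE[OF assms(2)], rule that)
  \<comment> \<open>Arguments of \<open>H\<close> have the form \<open>pr (pr x T) i\<close>; the
    successor makes \<open>T\<close> an inclusive bound for the witness.\<close>
  let ?N = "\<lambda>g w. Suc (p2 (p1 w))"
  have "\<exists>H. rc H \<and> (\<forall>g w. H g w = 0 \<longleftrightarrow>
      (\<exists>t<?N g w. F g (pr (pr (p1 (p1 w)) (p2 w)) t) = 0))"
    by (rule rc_bex) (intro rc_intros rc_comp[OF F(1)])+
  then obtain H where H: "rc H" "\<And>g w. H g w = 0 \<longleftrightarrow>
      (\<exists>t<?N g w. F g (pr (pr (p1 (p1 w)) (p2 w)) t) = 0)" by blast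
  have "rc (\<lambda>g w. H g (pr (p1 w) (p2 w)))" using H(1) by simp
  from rc_ball[of "\<lambda>g w i. H g (pr w i)" "\<lambda>g w. N g (p1 w)", OF this]
  obtain K where K: "rc K" "\<And>g w. K g w = 0 \<longleftrightarrow> (\<forall>i<N g (p1 w). H g (pr w i) = 0)"
    using rc_at_p1[OF assms(1)] by blast
  show ?thesis
  proof (rule ceI[where F = "\<lambda>g x T. K g (pr x T)"])
    show "rc (\<lambda>g w. K g (pr (p1 w) (p2 w)))" using K(1) by simp
    fix g x
    have F': "P g x i \<longleftrightarrow> (\<exists>t. F g (pr (pr x i) t) = 0)" for i
      using F(2)[of g "pr x i"] by simp
    have "(\<exists>T. \<forall>i<n. \<exists>t<Suc T. F g (pr (pr x i) t) = 0) \<longleftrightarrow> (\<forall>i<n. P g x i)" for n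
    proof (induction n)
      case (Suc n)
      show ?case
      proof
        assume "\<forall>i<Suc n. P g x i"
        then obtain T t where T: "\<forall>i<n. \<exists>t<Suc T. F g (pr (pr x i) t) = 0" and t: "F g (pr (pr x n) t) = 0"
          using Suc F' by (metis less_Suc_eq)
        then have "\<forall>i<Suc n. \<exists>t'<Suc (T + t). F g (pr (pr x i) t') = 0"
          by (metis add.commute less_Suc_eq trans_less_add1 plus_nat.simps(2))
        then show "\<exists>T. \<forall>i<Suc n. \<exists>t<Suc T. F g (pr (pr x i) t) = 0" by blast
      qed (use F' in blast)
    qed simp
    then show "(\<forall>i<N g x. P g x i) \<longleftrightarrow> (\<exists>T. K g (pr x T) = 0)"
      by (simp add: K(2) H(2))
  qed
qed

lemma ce_comp: "ce P \<Longrightarrow> rc G \<Longrightarrow> ce (\<lambda>g x. P g (G g x))"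
proof (elim ceE)
  fix F assume F: "rc F" "\<And>g x. P g x \<longleftrightarrow> (\<exists>t. F g (pr x t) = 0)" and G: "rc G"
  show ?thesis
    by (rule ceI[where F = "\<lambda>g x t. F g (pr (G g x) t)"])
      (intro rc_intros rc_comp[OF F(1)] rc_at_p1 G, simp add: F(2))
qed

lemma ce_mem [ce_intros]: "rc G \<Longrightarrow> rc H \<Longrightarrow> ce (\<lambda>g x. G g x \<in> set (list_decode (H g x)))"
proof -
  assume G: "rc G" and H: "rc H"
  have "ce (\<lambda>g x. \<exists>i. i < llen (H g x) \<and> lnth (H g x) i = G g x)"
    by (intro ce_intros rc_intros rc_comp[OF G] rc_comp[OF H])
  then show ?thesis by (simp add: in_set_conv_nth lnth_def llen_def cong: conj_cong)
qed

section \<open>Finite derivations under a monotone rule\<close>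

text \<open>A derivation lists the newest element first: every element follows from the elements after it.\<close>

primrec derivation :: "(nat \<Rightarrow> nat set \<Rightarrow> bool) \<Rightarrow> nat list \<Rightarrow> bool" where
  "derivation \<Psi> [] = True"
| "derivation \<Psi> (x # l) = (\<Psi> x (set l) \<and> derivation \<Psi> l)"

definition derivable :: "(nat \<Rightarrow> nat set \<Rightarrow> bool) \<Rightarrow> nat \<Rightarrow> bool" where
  "derivable \<Psi> x \<longleftrightarrow> (\<exists>l. derivation \<Psi> (x # l))"

lemma derivation_append:
  assumes "\<And>x S T. \<Psi> x S \<Longrightarrow> S \<subseteq> T \<Longrightarrow> \<Psi> x T"
  shows "derivation \<Psi> l \<Longrightarrow> derivation \<Psi> m \<Longrightarrow> derivation \<Psi> (l @ m)"
  by (induction l) (auto intro: assms)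

text \<open>Derivations of the finitely many premises are concatenated. Monotonicity keeps every
  rule instance valid when further elements follow it.\<close>

lemma derivableI:
  assumes mono: "\<And>x S T. \<Psi> x S \<Longrightarrow> S \<subseteq> T \<Longrightarrow> \<Psi> x T"
    and "\<Psi> x S" "finite S" "\<And>s. s \<in> S \<Longrightarrow> derivable \<Psi> s"
  shows "derivable \<Psi> x"
proof -
  have "\<exists>l. derivation \<Psi> l \<and> S \<subseteq> set l"
    using assms(3,4)
  proof (induction S)
    case empty
    show ?case by (rule exI[of _ "[]"]) auto
  next
    case (insert s S)
    obtain l where l: "derivation \<Psi> l" "S \<subseteq> set l" using insert by blast
    obtain m where m: "derivation \<Psi> (s # m)" using insert.prems unfolding derivable_def by blast
    have "derivation \<Psi> ((s # m) @ l)" using derivation_append[OF mono m l(1)] .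
    then show ?case using l by (intro exI[of _ "(s # m) @ l"]) auto
  qed
  then show ?thesis unfolding derivable_def using mono assms(2) by auto
qed

lemma derivable_induct:
  assumes "derivable \<Psi> x" and step: "\<And>x S. \<Psi> x S \<Longrightarrow> (\<And>s. s \<in> S \<Longrightarrow> Q s) \<Longrightarrow> Q x"
  shows "Q x"
proof -
  have "derivation \<Psi> l \<Longrightarrow> \<forall>x\<in>set l. Q x" for l
  proof (induction l)
    case (Cons a l)
    then show ?case using step[of a "set l"] by auto
  qed simp
  moreover obtain l where "derivation \<Psi> (x # l)" using assms(1) unfolding derivable_def by blast
  ultimately show ?thesis by (meson list.set_intros(1))
qed

lemma derivation_iff:
  "derivation \<Psi> l \<longleftrightarrow> (\<forall>i<length l. \<Psi> (l ! i) (set (drop (Suc i) l)))"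
proof (induction l)
  case (Cons x l)
  have "(\<forall>i<Suc n. P i) \<longleftrightarrow> P 0 \<and> (\<forall>i<n. P (Suc i))" for n and P :: "nat \<Rightarrow> bool"
    by (auto simp: less_Suc_eq_0_disj)
  with Cons show ?case by simp
qed simp

text \<open>The search guesses the code \<open>L\<close> of a whole derivation. By
  \<open>derivation_iff\<close> it is checked entry by entry, the premises available to entry
  \<open>i\<close> being the suffix \<open>ldrop (Suc i) L\<close>. The parameter
  \<open>A g x\<close> lets the rule depend on the input, as the simulated oracle does.\<close>

lemma ce_derivable:
  assumes "ce (\<lambda>g w. \<Psi> g (p1 w) (p1 (p2 w)) (set (list_decode (p2 (p2 w)))))" "rc A" "rc G"
  shows "ce (\<lambda>g x. derivable (\<Psi> g (A g x)) (G g x))"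
proof -
  let ?Q = "\<lambda>g w. \<Psi> g (p1 w) (p1 (p2 w)) (set (list_decode (p2 (p2 w))))"
  have "ce (\<lambda>g x. \<exists>L. 0 < llen L \<and> lnth L 0 = G g x \<and>
      (\<forall>i<llen L. ?Q g (pr (A g x) (pr (lnth L i) (ldrop (Suc i) L)))))"
    by (intro ce_intros rc_intros ce_comp[OF assms(1)] rc_comp[OF assms(2)] rc_comp[OF assms(3)])
  moreover have "(\<exists>L. 0 < llen L \<and> lnth L 0 = y \<and>
      (\<forall>i<llen L. ?Q g (pr a (pr (lnth L i) (ldrop (Suc i) L))))) \<longleftrightarrow> derivable (\<Psi> g a) y" for g a y
  proof -
    have "derivable (\<Psi> g a) y \<longleftrightarrow> (\<exists>l. l \<noteq> [] \<and> l ! 0 = y \<and> derivation (\<Psi> g a) l)"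
      unfolding derivable_def by (metis list.distinct(1) neq_Nil_conv nth_Cons_0)
    also have "\<dots> \<longleftrightarrow> (\<exists>L. list_decode L \<noteq> [] \<and> list_decode L ! 0 = y \<and> derivation (\<Psi> g a) (list_decode L))"
      by (metis list_encode_inverse)
    finally show ?thesis
      by (auto simp add: derivation_iff llen_def lnth_def ldrop_def)
  qed
  ultimately show ?thesis by simp
qed

section \<open>Rational arithmetic\<close>

text \<open>Signs are represented by differences of naturals and fractions are not reduced, so
  comparison becomes a decidable inequality between naturals. There is no closure rule for division;
  the inequalities in the certificates are therefore multiplied out.\<close>

definition rq :: "((nat \<Rightarrow> nat) \<Rightarrow> nat \<Rightarrow> real) \<Rightarrow> bool" where
  "rq T \<longleftrightarrow> (\<exists>P N D. rc P \<and> rc N \<and> rc D \<and>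
     (\<forall>g x. D g x > 0 \<and> T g x = (real (P g x) - real (N g x)) / real (D g x)))"

lemma rqI:
  assumes "rc P" "rc N" "rc D" "\<And>g x. D g x > 0"
    "\<And>g x. T g x = (real (P g x) - real (N g x)) / real (D g x)"
  shows "rq T"
  unfolding rq_def using assms by blast

named_theorems rq_intros

lemma rq_of_nat [rq_intros]: "rc n \<Longrightarrow> rq (\<lambda>g x. real (n g x))"
  by (rule rqI[where P = n and N = "\<lambda>g x. 0" and D = "\<lambda>g x. 1"]) (auto intro: rc_intros)

lemma rq_const [rq_intros]: "rq (\<lambda>g x. 0)" "rq (\<lambda>g x. 1)" "rq (\<lambda>g x. numeral k)"
  using rq_of_nat[OF rc_const, of 0] rq_of_nat[OF rc_const, of 1] rq_of_nat[OF rc_const, of "numeral k"]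
  by simp_all

lemma rq_add [rq_intros]: "rq S \<Longrightarrow> rq T \<Longrightarrow> rq (\<lambda>g x. S g x + T g x)"
  unfolding rq_def[of S] rq_def[of T]
proof (elim exE conjE)
  fix P N D P' N' D'
  assume *: "rc P" "rc N" "rc D" "rc P'" "rc N'" "rc D'"
    and 1: "\<forall>g x. 0 < D g x \<and> S g x = (real (P g x) - real (N g x)) / real (D g x)"
    and 2: "\<forall>g x. 0 < D' g x \<and> T g x = (real (P' g x) - real (N' g x)) / real (D' g x)"
  show ?thesis
  proof (rule rqI[where P = "\<lambda>g x. P g x * D' g x + P' g x * D g x"
        and N = "\<lambda>g x. N g x * D' g x + N' g x * D g x" and D = "\<lambda>g x. D g x * D' g x"])
    fix g x
    have "D g x \<noteq> 0" "D' g x \<noteq> 0" using 1 2 by (metis less_irrefl)+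
    then show "S g x + T g x = (real (P g x * D' g x + P' g x * D g x) - real (N g x * D' g x + N' g x * D g x)) / real (D g x * D' g x)"
      using 1 2 by (simp add: field_simps)
  qed (use 1 2 in \<open>auto intro!: rc_intros *\<close>)
qed

lemma rq_diff [rq_intros]: "rq S \<Longrightarrow> rq T \<Longrightarrow> rq (\<lambda>g x. S g x - T g x)"
  unfolding rq_def[of S] rq_def[of T]
proof (elim exE conjE)
  fix P N D P' N' D'
  assume *: "rc P" "rc N" "rc D" "rc P'" "rc N'" "rc D'"
    and 1: "\<forall>g x. 0 < D g x \<and> S g x = (real (P g x) - real (N g x)) / real (D g x)"
    and 2: "\<forall>g x. 0 < D' g x \<and> T g x = (real (P' g x) - real (N' g x)) / real (D' g x)"
  show ?thesis
  proof (rule rqI[where P = "\<lambda>g x. P g x * D' g x + N' g x * D g x"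
        and N = "\<lambda>g x. N g x * D' g x + P' g x * D g x" and D = "\<lambda>g x. D g x * D' g x"])
    fix g x
    have "D g x \<noteq> 0" "D' g x \<noteq> 0" using 1 2 by (metis less_irrefl)+
    then show "S g x - T g x = (real (P g x * D' g x + N' g x * D g x) - real (N g x * D' g x + P' g x * D g x)) / real (D g x * D' g x)"
      using 1 2 by (simp add: field_simps)
  qed (use 1 2 in \<open>auto intro!: rc_intros *\<close>)
qed

lemma rq_minus [rq_intros]: "rq T \<Longrightarrow> rq (\<lambda>g x. - T g x)"
  using rq_diff[OF rq_const(1), of T] by simp

lemma rq_mult [rq_intros]: "rq S \<Longrightarrow> rq T \<Longrightarrow> rq (\<lambda>g x. S g x * T g x)"
  unfolding rq_def[of S] rq_def[of T]
proof (elim exE conjE)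
  fix P N D P' N' D'
  assume *: "rc P" "rc N" "rc D" "rc P'" "rc N'" "rc D'"
    and 1: "\<forall>g x. 0 < D g x \<and> S g x = (real (P g x) - real (N g x)) / real (D g x)"
    and 2: "\<forall>g x. 0 < D' g x \<and> T g x = (real (P' g x) - real (N' g x)) / real (D' g x)"
  show ?thesis
  proof (rule rqI[where P = "\<lambda>g x. P g x * P' g x + N g x * N' g x"
        and N = "\<lambda>g x. P g x * N' g x + N g x * P' g x" and D = "\<lambda>g x. D g x * D' g x"])
    fix g x
    have "D g x \<noteq> 0" "D' g x \<noteq> 0" using 1 2 by (metis less_irrefl)+
    then show "S g x * T g x = (real (P g x * P' g x + N g x * N' g x) - real (P g x * N' g x + N g x * P' g x)) / real (D g x * D' g x)"
      using 1 2 by (simp add: field_simps)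
  qed (use 1 2 in \<open>auto intro!: rc_intros *\<close>)
qed

text \<open>\<open>int_decode\<close> sends even \<open>a\<close> to \<open>a div 2\<close> and odd
  \<open>a\<close> to \<open>- (a div 2) - 1\<close>; \<open>a - 2 * (a div 2)\<close> tests parity
  within \<open>rc\<close>.\<close>

lemma qdec_eq: "qdec n =
   (real (if p1 n - 2 * (p1 n div 2) = 0 then p1 n div 2 else 0) -
    real (if p1 n - 2 * (p1 n div 2) = 0 then 0 else Suc (p1 n div 2))) / real (Suc (p2 n))"
proof -
  have "real_of_int (int_decode a) =
     real (if a - 2 * (a div 2) = 0 then a div 2 else 0) -
     real (if a - 2 * (a div 2) = 0 then 0 else Suc (a div 2))" for a
  proof (cases "even a")
    case True
    then show ?thesis by (simp add: int_decode_def sum_decode_def)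
  next
    case False
    then have "a = Suc (2 * (a div 2))" by presburger
    then have "a - 2 * (a div 2) = 1" by linarith
    then show ?thesis using False by (simp add: int_decode_def sum_decode_def)
  qed
  then show ?thesis by (simp add: qdec_def p1_def p2_def split: prod.splits)
qed

lemma rq_qdec [rq_intros]: "rc n \<Longrightarrow> rq (\<lambda>g x. qdec (n g x))"
  by (rule rqI[OF _ _ _ _ qdec_eq]) (intro rc_intros; assumption | simp)+

lemma ce_rq_less [ce_intros]: "rq S \<Longrightarrow> rq T \<Longrightarrow> ce (\<lambda>g x. S g x < T g x)"
  unfolding rq_def[of S] rq_def[of T]
proof (elim exE conjE)
  fix P N D P' N' D'
  assume *: "rc P" "rc N" "rc D" "rc P'" "rc N'" "rc D'"
    and 1: "\<forall>g x. 0 < D g x \<and> S g x = (real (P g x) - real (N g x)) / real (D g x)"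
    and 2: "\<forall>g x. 0 < D' g x \<and> T g x = (real (P' g x) - real (N' g x)) / real (D' g x)"
  have "S g x < T g x \<longleftrightarrow> P g x * D' g x + N' g x * D g x < P' g x * D g x + N g x * D' g x" for g x
  proof -
    have pos: "real (D g x) > 0" "real (D' g x) > 0" using 1 2 by simp_all
    then have "S g x < T g x \<longleftrightarrow>
        real (P g x * D' g x + N' g x * D g x) < real (P' g x * D g x + N g x * D' g x)"
      using 1 2 by (simp add: field_simps)
    then show ?thesis by linarith
  qed
  then show ?thesis by simp (intro ce_intros rc_intros *)
qed

lemma ce_rq_le [ce_intros]: "rq S \<Longrightarrow> rq T \<Longrightarrow> ce (\<lambda>g x. S g x \<le> T g x)"
  unfolding rq_def[of S] rq_def[of T]
proof (elim exE conjE)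
  fix P N D P' N' D'
  assume *: "rc P" "rc N" "rc D" "rc P'" "rc N'" "rc D'"
    and 1: "\<forall>g x. 0 < D g x \<and> S g x = (real (P g x) - real (N g x)) / real (D g x)"
    and 2: "\<forall>g x. 0 < D' g x \<and> T g x = (real (P' g x) - real (N' g x)) / real (D' g x)"
  have "S g x \<le> T g x \<longleftrightarrow> P g x * D' g x + N' g x * D g x \<le> P' g x * D g x + N g x * D' g x" for g x
  proof -
    have pos: "real (D g x) > 0" "real (D' g x) > 0" using 1 2 by simp_all
    then have "S g x \<le> T g x \<longleftrightarrow>
        real (P g x * D' g x + N' g x * D g x) \<le> real (P' g x * D g x + N g x * D' g x)"
      using 1 2 by (simp add: field_simps)
    then show ?thesis by linarith
  qed
  then show ?thesis by simp (intro ce_intros rc_intros *)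
qed

lemma qdec_dense: assumes "a < b" shows "\<exists>n. a < qdec n \<and> qdec n < b"
proof -
  obtain q where q: "q \<in> \<rat>" "a < q" "q < b" using Rats_dense_in_real[OF assms] by blast
  then obtain i :: int and m :: nat where m: "m \<noteq> 0" "q = real_of_int i / real m"
    by (auto simp: Rats_eq_int_div_nat)
  \<comment> \<open>\<open>qdec\<close> divides by the second component plus one.\<close>
  have "qdec (pr (int_encode i) (m - 1)) = q"
    using m by (simp add: qdec_def of_nat_diff)
  then show ?thesis using q by metis
qed

lemma qdec_of_int: "qdec (pr (int_encode i) 0) = real_of_int i"
  by (simp add: qdec_def)

lemma rbasic_iff: "x \<in> rbasic n \<longleftrightarrow> qdec (p1 n) < x \<and> x < qdec (p2 n)"
  by (auto simp: rbasic_def p1_def p2_def split: prod.splits)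

text \<open>An enumerating machine must never run out of entries; moving the right end point of one
  interval outwards supplies infinitely many codes.\<close>

lemma infinite_rbasic: "infinite {n. x \<in> rbasic n}"
proof -
  let ?f = "\<lambda>k :: nat. pr (pr (int_encode (\<lfloor>x\<rfloor> - 1)) 0) (pr (int_encode (\<lfloor>x\<rfloor> + 1 + int k)) 0)"
  have "inj ?f" by (auto simp: inj_def int_encode_eq)
  moreover have "range ?f \<subseteq> {n. x \<in> rbasic n}"
    by (auto simp: rbasic_iff qdec_of_int) linarith+
  ultimately show ?thesis by (meson finite_subset range_inj_infinite)
qed

text \<open>Entry \<open>t\<close> is the first component of the least accepted pair that is at
  least \<open>t\<close>. An infinite set has accepted pairs beyond every bound, so each search
  ends, and every accepted pair is reached at its own index.\<close>

lemma ce_enumerate: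
  assumes "ce P"
  shows "\<exists>e. \<forall>g. infinite {n. P g n} \<longrightarrow> (\<exists>q. writes e g q \<and> range q = {n. P g n})"
proof -
  obtain F where F: "rc F" "\<And>g x. P g x \<longleftrightarrow> (\<exists>t. F g (pr x t) = 0)"
    by (rule ceE[OF assms], rule that)
  let ?H = "\<lambda>g xs. (xs ! 1 - xs ! 0) + F g (xs ! 0)"
  have "rcn 1 (\<lambda>g xs. F g (xs ! 0))" using F(1) by (simp add: rc_iff)
  from rcn_comp1[OF this rcn_proj[of 0 2]]
  have "rcn 2 ?H"
    by (intro rcn_app2[OF rc2_add] rcn_app2[OF rc2_diff] rcn_proj) auto
  then obtain f where f: "computes f 2 ?H" unfolding rcn_def by blast
  obtain d where d: "\<forall>g x. eval d g [x] (p1 x)" using rc_p1[OF rc_id] unfolding rc_def by blast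
  show ?thesis
  proof (intro exI allI impI)
    fix g assume inf: "infinite {n. P g n}"
    have ex: "\<exists>s. s \<ge> t \<and> F g s = 0" for t
    proof (rule ccontr)
      assume "\<not> ?thesis"
      then have *: "\<forall>s\<ge>t. F g s \<noteq> 0" by simp
      have "{n. P g n} \<subseteq> p1 ` {s. s < t}"
      proof clarify
        fix n assume "P g n"
        then obtain k where "F g (pr n k) = 0" using F(2) by blast
        then have "pr n k < t" using * not_less by metis
        then show "n \<in> p1 ` {s. s < t}" by (intro image_eqI[of _ _ "pr n k"]) auto
      qed
      then show False using inf finite_subset by blast
    qed
    define s where "s t = (LEAST s. s \<ge> t \<and> F g s = 0)" for t
    have s: "s t \<ge> t \<and> F g (s t) = 0" for t unfolding s_def using ex by (rule LeastI_ex)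
    have ev: "eval f g [m, t] ((t - m) + F g m)" for m t
      using f unfolding computes_def by (auto dest!: spec[of _ "[m, t]"])
    \<comment> \<open>The evaluation is built directly, not by \<open>rcn_least\<close>, because the
      search is known to succeed only for oracles with an infinite set.\<close>
    have 1: "eval (Mn f) g [t] (s t)" for t
    proof (rule ev_mn)
      show "eval f g [s t, t] 0" using ev[of "s t" t] s[of t] by simp
      show "\<forall>m<s t. \<exists>y. y \<noteq> 0 \<and> eval f g [m, t] y"
      proof (intro allI impI)
        fix m assume "m < s t"
        then have "\<not> (m \<ge> t \<and> F g m = 0)" unfolding s_def by (rule not_less_Least)
        then show "\<exists>y. y \<noteq> 0 \<and> eval f g [m, t] y"
          by (intro exI[of _ "(t - m) + F g m"]) (auto intro: ev)
      qed
    qed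
    show "writes (Comp d [Mn f]) g (\<lambda>t. p1 (s t)) \<and> range (\<lambda>t. p1 (s t)) = {n. P g n}"
    proof
      show "writes (Comp d [Mn f]) g (\<lambda>t. p1 (s t))"
        unfolding writes_def
        by (intro allI ev_comp[where ys = "[s _]"]) (use 1 d in auto)
      show "range (\<lambda>t. p1 (s t)) = {n. P g n}"
      proof (intro set_eqI iffI; clarify)
        fix t show "P g (p1 (s t))"
          unfolding F(2) using s[of t] by (metis p_pr(3))
      next
        fix n assume "P g n"
        then obtain t where "F g (pr n t) = 0" using F(2) by blast
        then have "s (pr n t) = pr n t" unfolding s_def by (intro Least_equality) auto
        then show "n \<in> range (\<lambda>t. p1 (s t))" by (metis p_pr(1) rangeI)
      qed
    qed
  qed
qed

section \<open>A universal machine with a partial oracle\<close>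

text \<open>Needed to identify the result of a simulated run with the entry that the machine is
  known to write.\<close>

lemma eval_det: "eval e g xs y \<Longrightarrow> eval e g xs y' \<Longrightarrow> y = y'"
proof (induction arbitrary: y' rule: eval.induct)
  case (ev_comp ys hs g xs f z)
  from ev_comp.prems obtain ys' where ys': "length ys' = length hs"
    "\<forall>i<length hs. eval (hs ! i) g xs (ys' ! i)" "eval f g ys' y'"
    by (cases rule: eval.cases) auto
  have "ys' = ys" using ev_comp.IH(1) ev_comp.hyps ys' by (metis nth_equalityI)
  then show ?case using ev_comp.IH(2) ys' by blast
next
  case (ev_primS f h g n xs y z)
  from ev_primS.prems show ?case
    by (cases rule: eval.cases) (use ev_primS.IH in blast)
next
  case (ev_mn f g n xs)
  from ev_mn.prems have 0: "eval f g (y' # xs) 0" and less: "\<forall>m<y'. \<exists>y. y \<noteq> 0 \<and> eval f g (m # xs) y"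
    by (cases rule: eval.cases, auto)+
  show ?case
  proof (rule linorder_cases[of n y'])
    assume "n < y'"
    then show ?thesis using less ev_mn.IH(1) by metis
  next
    assume "y' < n"
    then show ?thesis using 0 ev_mn.IH(2) by metis
  qed
next
  case ev_prim0
  from ev_prim0.prems show ?case
    by (cases rule: eval.cases) (use ev_prim0.IH in blast)
qed (erule eval.cases; simp; fail)+

text \<open>The rules of \<open>eval\<close> on codes: the tags 0 to 6 are those of
  \<open>enc\<close>, and \<open>Suc (pr a r)\<close> codes a nonempty list. The oracle is a
  relation \<open>Qr\<close>, so that finite partial information about it can be presented.\<close>

definition ev_step :: "(nat \<Rightarrow> nat \<Rightarrow> bool) \<Rightarrow> nat \<Rightarrow> nat \<Rightarrow> nat \<Rightarrow> nat set \<Rightarrow> bool" where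
  "ev_step Qr c xs y S \<longleftrightarrow>
    c = pr 0 0 \<and> y = 0 \<or>
    (\<exists>a r. c = pr 1 0 \<and> xs = Suc (pr a r) \<and> y = Suc a) \<or>
    (\<exists>i. c = pr 2 i \<and> i < llen xs \<and> lnth xs i = y) \<or>
    (\<exists>f hs ys. c = pr 3 (pr f hs) \<and> llen ys = llen hs \<and>
        (\<forall>i<llen hs. pr (lnth hs i) (pr xs (lnth ys i)) \<in> S) \<and> pr f (pr ys y) \<in> S) \<or>
    (\<exists>f h r. c = pr 4 (pr f h) \<and> xs = Suc (pr 0 r) \<and> pr f (pr r y) \<in> S) \<or>
    (\<exists>f h n r y'. c = pr 4 (pr f h) \<and> xs = Suc (pr (Suc n) r) \<and>
        pr c (pr (Suc (pr n r)) y') \<in> S \<and> pr h (pr (Suc (pr y' (Suc (pr n r)))) y) \<in> S) \<or>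
    (\<exists>f. c = pr 5 f \<and> pr f (pr (Suc (pr y xs)) 0) \<in> S \<and>
        (\<forall>m<y. \<exists>y'. y' \<noteq> 0 \<and> pr f (pr (Suc (pr m xs)) y') \<in> S)) \<or>
    (\<exists>a r. c = pr 6 0 \<and> xs = Suc (pr a r) \<and> Qr a y)"

definition ev_rule :: "(nat \<Rightarrow> nat \<Rightarrow> bool) \<Rightarrow> nat \<Rightarrow> nat set \<Rightarrow> bool" where
  "ev_rule Qr x S \<longleftrightarrow> ev_step Qr (p1 x) (p1 (p2 x)) (p2 (p2 x)) S"

lemma ev_rule_mono: "ev_rule Qr x S \<Longrightarrow> S \<subseteq> T \<Longrightarrow> ev_rule Qr x T"
  unfolding ev_rule_def ev_step_def by (elim disj_forward ex_forward conj_forward) blast+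

lemma ev_rule_mono_oracle:
  "ev_rule Qr x S \<Longrightarrow> (\<And>a y. Qr a y \<Longrightarrow> Qr' a y) \<Longrightarrow> ev_rule Qr' x S"
  unfolding ev_rule_def ev_step_def by (elim disj_forward ex_forward conj_forward) auto

lemma llen_list_encode [simp]: "llen (list_encode l) = length l"
  by (simp add: llen_def)

lemma lnth_list_encode [simp]: "i < length l \<Longrightarrow> lnth (list_encode l) i = l ! i"
  by (simp add: lnth_def)

lemma list_encode_eq_Suc: "list_encode l = Suc (pr a r) \<longleftrightarrow> (\<exists>l'. l = a # l' \<and> r = list_encode l')"
  by (cases l) auto

abbreviation ev_code :: "rf \<Rightarrow> nat list \<Rightarrow> nat \<Rightarrow> nat" where
  "ev_code e xs y \<equiv> pr (enc e) (pr (list_encode xs) y)"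

text \<open>A derivation may contain numbers that code no program, and nothing is claimed of those.
  The induction still works because the premises used for a genuine program refer again to genuine
  programs.\<close>

lemma ev_rule_sound:
  assumes Qr: "\<And>a y. Qr a y \<Longrightarrow> g a = y" and x: "derivable (ev_rule Qr) x"
  shows "\<forall>e xs y. x = ev_code e xs y \<longrightarrow> eval e g xs y"
  using x
proof (rule derivable_induct)
  fix x S
  assume x: "ev_rule Qr x S" and "\<And>s. s \<in> S \<Longrightarrow> \<forall>e xs y. s = ev_code e xs y \<longrightarrow> eval e g xs y"
  then have IH: "eval e g xs y" if "ev_code e xs y \<in> S" for e xs y using that by blast
  show "\<forall>e xs y. x = ev_code e xs y \<longrightarrow> eval e g xs y"
  proof (intro allI impI)
    fix e xs y assume "x = ev_code e xs y"
    then have "ev_step Qr (enc e) (list_encode xs) y S" using x by (simp add: ev_rule_def)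
    then consider "enc e = pr 0 0" "y = 0"
      | a r where "enc e = pr 1 0" "list_encode xs = Suc (pr a r)" "y = Suc a"
      | i where "enc e = pr 2 i" "i < length xs" "xs ! i = y"
      | f hs ys where "enc e = pr 3 (pr f hs)" "llen ys = llen hs"
         "\<forall>i<llen hs. pr (lnth hs i) (pr (list_encode xs) (lnth ys i)) \<in> S" "pr f (pr ys y) \<in> S"
      | f h r where "enc e = pr 4 (pr f h)" "list_encode xs = Suc (pr 0 r)" "pr f (pr r y) \<in> S"
      | f h n r y' where "enc e = pr 4 (pr f h)" "list_encode xs = Suc (pr (Suc n) r)"
        "pr (enc e) (pr (Suc (pr n r)) y') \<in> S" "pr h (pr (Suc (pr y' (Suc (pr n r)))) y) \<in> S"
      | f where "enc e = pr 5 f" "pr f (pr (Suc (pr y (list_encode xs))) 0) \<in> S"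
        "\<forall>m<y. \<exists>y'. y' \<noteq> 0 \<and> pr f (pr (Suc (pr m (list_encode xs))) y') \<in> S"
      | a r where "enc e = pr 6 0" "list_encode xs = Suc (pr a r)" "Qr a y"
      unfolding ev_step_def by (auto)
    then show "eval e g xs y"
    proof cases
      case 1
      then show ?thesis by (cases e) (auto intro: ev_zero)
    next
      case 2
      then show ?thesis by (cases e) (auto simp: list_encode_eq_Suc intro: ev_succ)
    next
      case 3
      then show ?thesis by (cases e) (auto intro: ev_proj)
    next
      case 4
      then obtain f' hs' where e: "e = Comp f' hs'" "f = enc f'" "hs = list_encode (map enc hs')"
        by (cases e) auto
      obtain ys' where ys: "ys = list_encode ys'" by (metis list_decode_inverse)
      show ?thesis unfolding e(1)
        by (rule ev_comp[where ys = ys']) (use 4 e ys IH in auto)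
    next
      case 5
      then obtain f' h' where e: "e = Prim f' h'" "f = enc f'" by (cases e) auto
      obtain r' where r: "xs = 0 # r'" "r = list_encode r'" using 5 by (auto simp: list_encode_eq_Suc)
      show ?thesis unfolding e(1) r(1) by (rule ev_prim0) (use 5 e r IH in auto)
    next
      case 6
      then obtain f' h' where e: "e = Prim f' h'" "f = enc f'" "h = enc h'" by (cases e) auto
      obtain r' where r: "xs = Suc n # r'" "r = list_encode r'" using 6 by (auto simp: list_encode_eq_Suc)
      show ?thesis unfolding e(1) r(1)
      proof (rule ev_primS)
        show "eval (Prim f' h') g (n # r') y'" using 6(3) r e by (intro IH) simp
        show "eval h' g (y' # n # r') y" using 6(4) r e by (intro IH) simp
      qed
    next
      case 7
      then obtain f' where e: "e = Mn f'" "f = enc f'" by (cases e) auto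
      show ?thesis unfolding e(1)
      proof (rule ev_mn)
        show "eval f' g (y # xs) 0" using 7(2) e by (intro IH) simp
        show "\<forall>m<y. \<exists>y. y \<noteq> 0 \<and> eval f' g (m # xs) y"
          using 7(3) e IH[of f' "_ # xs"] by (simp del: enc.simps) blast
      qed
    next
      case 8
      then show ?thesis using Qr by (cases e) (auto simp: list_encode_eq_Suc intro: ev_orc)
    qed
  qed
qed

lemma derivable_mono:
  assumes "derivable \<Psi> x" "\<And>x S. \<Psi> x S \<Longrightarrow> \<Psi>' x S"
  shows "derivable \<Psi>' x"
proof -
  have "derivation \<Psi> l \<Longrightarrow> derivation \<Psi>' l" for l
    by (induction l) (use assms(2) in auto)
  then show ?thesis using assms(1) unfolding derivable_def by blast
qed

lemma ev_derivableI:
  assumes "ev_rule Qr x S" "finite S" "\<And>s. s \<in> S \<Longrightarrow> derivable (ev_rule Qr) s"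
  shows "derivable (ev_rule Qr) x"
  by (rule derivableI[OF ev_rule_mono assms])

text \<open>A terminating computation consults only a finite part of the oracle.\<close>

lemma ev_rule_complete:
  fixes Qr :: "nat \<Rightarrow> nat \<Rightarrow> nat \<Rightarrow> bool"
  assumes mono: "\<And>m n a y. m \<le> n \<Longrightarrow> Qr m a y \<Longrightarrow> Qr n a y"
    and "eval e g xs y" and ex: "\<And>a. \<exists>n. Qr n a (g a)"
  shows "\<exists>n. derivable (ev_rule (Qr n)) (ev_code e xs y)"
proof -
  let ?D = "\<lambda>n x. derivable (ev_rule (Qr n)) x"
  have D_mono: "?D n x" if "?D m x" "m \<le> n" for m n x
  proof (rule derivable_mono[OF that(1)])
    show "ev_rule (Qr n) x S" if "ev_rule (Qr m) x S" for x S
      using that mono[OF \<open>m \<le> n\<close>] by (rule ev_rule_mono_oracle)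
  qed
  \<comment> \<open>Finitely many premises may need different stages of the oracle; the largest
    stage serves all of them.\<close>
  have D_all: "\<exists>n. \<forall>x\<in>S. ?D n x" if "finite S" "\<forall>x\<in>S. \<exists>n. ?D n x" for S
    using that
  proof (induction S)
    case (insert s S)
    then obtain m n where "\<forall>x\<in>S. ?D n x" "?D m s" by auto
    then have "\<forall>x\<in>insert s S. ?D (max m n) x" using D_mono by (metis insertE max.cobounded1 max.cobounded2)
    then show ?case by blast
  qed simp
  have D_rule: "\<exists>n. ?D n x" if "finite S" "\<forall>s\<in>S. \<exists>n. ?D n s" "\<And>n. ev_rule (Qr n) x S" for S x
    using D_all[OF that(1,2)] ev_derivableI[OF that(3,1)] by blast
  show ?thesis using assms(2) ex
  proof (induction rule: eval.induct)
    case (ev_zero g xs)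
    show ?case by (rule D_rule[of "{}"]) (auto simp: ev_rule_def ev_step_def)
  next
    case (ev_succ g x xs)
    show ?case by (rule D_rule[of "{}"]) (auto simp: ev_rule_def ev_step_def)
  next
    case (ev_proj i xs g)
    then show ?case by (intro D_rule[of "{}"]) (auto simp: ev_rule_def ev_step_def)
  next
    case (ev_comp ys hs g xs f z)
    show ?case
    proof (rule D_rule[of "insert (ev_code f ys z) ((\<lambda>i. ev_code (hs ! i) xs (ys ! i)) ` {..<length hs})"])
      show "ev_rule (Qr n) (ev_code (Comp f hs) xs z)
         (insert (ev_code f ys z) ((\<lambda>i. ev_code (hs ! i) xs (ys ! i)) ` {..<length hs}))" for n
        unfolding ev_rule_def ev_step_def
        by (rule disjI2, rule disjI2, rule disjI2, rule disjI1,
            intro exI[of _ "enc f"] exI[of _ "list_encode (map enc hs)"] exI[of _ "list_encode ys"])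
          (use ev_comp.hyps in auto)
    qed (use ev_comp in auto)
  next
    case (ev_prim0 f g xs y h)
    show ?case
    proof (rule D_rule[of "{ev_code f xs y}"])
      show "ev_rule (Qr n) (ev_code (Prim f h) (0 # xs) y) {ev_code f xs y}" for n
        unfolding ev_rule_def ev_step_def by simp
    qed (use ev_prim0 in auto)
  next
    case (ev_primS f h g n xs y z)
    show ?case
    proof (rule D_rule[of "{ev_code (Prim f h) (n # xs) y, ev_code h (y # n # xs) z}"])
      show "ev_rule (Qr m) (ev_code (Prim f h) (Suc n # xs) z)
         {ev_code (Prim f h) (n # xs) y, ev_code h (y # n # xs) z}" for m
        unfolding ev_rule_def ev_step_def
        by (rule disjI2, rule disjI2, rule disjI2, rule disjI2, rule disjI2, rule disjI1,
            intro exI[of _ "enc f"] exI[of _ "enc h"] exI[of _ n] exI[of _ "list_encode xs"] exI[of _ y])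
          simp
    qed (use ev_primS in auto)
  next
    case (ev_mn f g n xs)
    have "\<forall>m<n. \<exists>y. y \<noteq> 0 \<and> (\<exists>k. ?D k (ev_code f (m # xs) y))" using ev_mn by blast
    then obtain Y where Y: "\<forall>m<n. Y m \<noteq> 0 \<and> (\<exists>k. ?D k (ev_code f (m # xs) (Y m)))" by metis
    show ?case
    proof (rule D_rule[of "insert (ev_code f (n # xs) 0) ((\<lambda>m. ev_code f (m # xs) (Y m)) ` {..<n})"])
      show "ev_rule (Qr k) (ev_code (Mn f) xs n)
          (insert (ev_code f (n # xs) 0) ((\<lambda>m. ev_code f (m # xs) (Y m)) ` {..<n}))" for k
        unfolding ev_rule_def ev_step_def
        by (rule disjI2, rule disjI2, rule disjI2, rule disjI2, rule disjI2, rule disjI2, rule disjI1,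
            intro exI[of _ "enc f"]) (use Y in auto)
    qed (use ev_mn Y in auto)
  next
    case (ev_orc g x xs)
    obtain n where "Qr n x (g x)" using ev_orc by blast
    then have "ev_rule (Qr n) (ev_code Orc (x # xs) (g x)) {}"
      unfolding ev_rule_def ev_step_def by simp
    from ev_derivableI[OF this] show ?case by blast
  qed
qed

lemma ce_ev_rule:
  assumes "ce (\<lambda>g w. Qr g (p1 w) (p1 (p2 w)) (p2 (p2 w)))" "rc A" "rc G"
  shows "ce (\<lambda>g x. derivable (ev_rule (Qr g (A g x))) (G g x))"
proof (rule ce_derivable[where \<Psi> = "\<lambda>g a. ev_rule (Qr g a)", OF _ assms(2,3)])
  have Qr: "ce (\<lambda>g x. Qr g (a g x) (b g x) (c g x))" if "rc a" "rc b" "rc c" for a b c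
    using ce_comp[OF assms(1), of "\<lambda>g x. pr (a g x) (pr (b g x) (c g x))"] that
    by (simp add: rc_intros)
  show "ce (\<lambda>g w. ev_rule (Qr g (p1 w)) (p1 (p2 w)) (set (list_decode (p2 (p2 w)))))"
    unfolding ev_rule_def ev_step_def by (intro ce_intros rc_intros Qr)
qed

section \<open>Harmonic conjugates on a disk\<close>

text \<open>The second difference of \<open>u\<close> over a square of side \<open>t\<close> is, by
  two applications of the mean value theorem in either order, \<open>t * t\<close> times a value of
  \<open>uxy\<close> and also of \<open>uyx\<close> in the square. Continuity at the corner
  \<open>z\<close> then excludes a gap.\<close>

lemma mixed_partials_eq:
  fixes u ux uy uxx uxy uyx uyy :: "complex \<Rightarrow> real"
  assumes D: "open D" "z \<in> D"
    and u: "\<And>z. z \<in> D \<Longrightarrow> (u has_derivative (\<lambda>h. ux z * Re h + uy z * Im h)) (at z)"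
    and ux: "\<And>z. z \<in> D \<Longrightarrow> (ux has_derivative (\<lambda>h. uxx z * Re h + uxy z * Im h)) (at z)"
    and uy: "\<And>z. z \<in> D \<Longrightarrow> (uy has_derivative (\<lambda>h. uyx z * Re h + uyy z * Im h)) (at z)"
    and cont: "continuous_on D uxy" "continuous_on D uyx"
  shows "uxy z = uyx z"
proof (rule ccontr)
  assume neq: "uxy z \<noteq> uyx z"
  define e where "e = \<bar>uxy z - uyx z\<bar> / 2"
  have e: "e > 0" using neq by (simp add: e_def)
  have "isCont uxy z" "isCont uyx z" using cont D continuous_on_eq_continuous_at by blast+
  then obtain d1 d2 where d: "d1 > 0" "d2 > 0"
     "\<And>w. dist w z < d1 \<Longrightarrow> dist (uxy w) (uxy z) < e"
     "\<And>w. dist w z < d2 \<Longrightarrow> dist (uyx w) (uyx z) < e"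
    unfolding continuous_at_eps_delta using e by metis
  obtain d3 where d3: "d3 > 0" "ball z d3 \<subseteq> D" using D openE by blast
  \<comment> \<open>Points of the square are within \<open>2 * t\<close> of \<open>z\<close>, so
    \<open>t\<close> has to be less than half of each radius.\<close>
  define t where "t = min d1 (min d2 d3) / 3"
  have t: "t > 0" "2 * t < d1" "2 * t < d2" "2 * t < d3"
    using d d3 by (auto simp: t_def)
  let ?P = "\<lambda>x y. z + Complex x y"
  have near: "dist (?P x y) z \<le> 2 * t" if "0 \<le> x" "x \<le> t" "0 \<le> y" "y \<le> t" for x y
    using cmod_le[of "Complex x y"] that by (simp add: dist_norm)
  have PD: "?P x y \<in> D" if "0 \<le> x" "x \<le> t" "0 \<le> y" "y \<le> t" for x y
    using near[OF that] t d3 by (force simp: dist_commute)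
  have Px: "((\<lambda>x. ?P x y) has_derivative (\<lambda>h. Complex h 0)) (at x)" for x y
    by (auto intro!: derivative_eq_intros simp: Complex_eq)
  have Py: "((\<lambda>y. ?P x y) has_derivative (\<lambda>h. Complex 0 h)) (at y)" for x y
    by (auto intro!: derivative_eq_intros simp: Complex_eq)
  have dx: "((\<lambda>x. f (?P x y)) has_real_derivative p) (at x)"
    if "(f has_derivative (\<lambda>h. p * Re h + q * Im h)) (at (?P x y))" for f p q x y
    using has_derivative_compose[OF Px that] by (simp add: has_field_derivative_def)
  have dy: "((\<lambda>y. f (?P x y)) has_real_derivative q) (at y)"
    if "(f has_derivative (\<lambda>h. p * Re h + q * Im h)) (at (?P x y))" for f p q x y
    using has_derivative_compose[OF Py that] by (simp add: has_field_derivative_def)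
  let ?\<Delta> = "u (?P t t) - u (?P t 0) - u (?P 0 t) + u (?P 0 0)"
  have "\<exists>x. 0 < x \<and> x < t \<and> (u (?P t t) - u (?P t 0)) - (u (?P 0 t) - u (?P 0 0))
      = (t - 0) * (ux (?P x t) - ux (?P x 0))"
    by (rule MVT2) (use t in \<open>auto intro!: DERIV_diff dx u PD\<close>)
  then obtain x where x: "0 < x" "x < t" "?\<Delta> = t * (ux (?P x t) - ux (?P x 0))" by auto
  have "\<exists>y. 0 < y \<and> y < t \<and> ux (?P x t) - ux (?P x 0) = (t - 0) * uxy (?P x y)"
    by (rule MVT2) (use t x in \<open>auto intro!: dy ux PD\<close>)
  then obtain y where y: "0 < y" "y < t" "?\<Delta> = t * (t * uxy (?P x y))" using x by auto
  have "\<exists>y. 0 < y \<and> y < t \<and> (u (?P t t) - u (?P 0 t)) - (u (?P t 0) - u (?P 0 0))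
      = (t - 0) * (uy (?P t y) - uy (?P 0 y))"
    by (rule MVT2) (use t in \<open>auto intro!: DERIV_diff dy u PD\<close>)
  then obtain y' where y': "0 < y'" "y' < t" "?\<Delta> = t * (uy (?P t y') - uy (?P 0 y'))" by auto
  have "\<exists>x. 0 < x \<and> x < t \<and> uy (?P t y') - uy (?P 0 y') = (t - 0) * uyx (?P x y')"
    by (rule MVT2) (use t y' in \<open>auto intro!: dx uy PD\<close>)
  then obtain x' where x': "0 < x'" "x' < t" "?\<Delta> = t * (t * uyx (?P x' y'))" using y' by auto
  have "uxy (?P x y) = uyx (?P x' y')" using x'(3) y(3) t(1) by simp
  moreover have "dist (uxy (?P x y)) (uxy z) < e"
    using near[of x y] x y t by (intro d(3)) auto
  moreover have "dist (uyx (?P x' y')) (uyx z) < e"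
    using near[of x' y'] x' y' t by (intro d(4)) auto
  moreover have "\<bar>uxy z - uyx z\<bar> = 2 * e" by (simp add: e_def)
  ultimately show False unfolding dist_real_def by linarith
qed

text \<open>\<open>ux - \<i> uy\<close> is holomorphic by Laplace's equation and the symmetry of the
  mixed derivatives, and the convex disk provides a primitive. Its additive constant is chosen to
  match \<open>u\<close> at \<open>z0\<close> and to make the imaginary part vanish there, which
  gives the chain a known initial value.\<close>

lemma harmonic_conjugate_exists:
  assumes "harmonic_on D u" "ball z0 R \<subseteq> D" and R: "R > 0"
  obtains f where "f holomorphic_on ball z0 R" "\<And>z. z \<in> ball z0 R \<Longrightarrow> Re (f z) = u z"
    "harmonic_on (ball z0 R) (\<lambda>z. Im (f z))" "Im (f z0) = 0"
proof -
  let ?B = "ball z0 R"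
  obtain ux uy uxx uxy uyx uyy where
    "open D"
    and u: "\<And>z. z \<in> D \<Longrightarrow> (u has_derivative (\<lambda>h. ux z * Re h + uy z * Im h)) (at z)"
    and ux: "\<And>z. z \<in> D \<Longrightarrow> (ux has_derivative (\<lambda>h. uxx z * Re h + uxy z * Im h)) (at z)"
    and uy: "\<And>z. z \<in> D \<Longrightarrow> (uy has_derivative (\<lambda>h. uyx z * Re h + uyy z * Im h)) (at z)"
    and cont: "continuous_on D uxx" "continuous_on D uxy" "continuous_on D uyx" "continuous_on D uyy"
    and lap: "\<And>z. z \<in> D \<Longrightarrow> uxx z + uyy z = 0"
    using assms(1) unfolding harmonic_on_def by blast
  have sym: "uxy z = uyx z" if "z \<in> D" for z
    using mixed_partials_eq[OF \<open>open D\<close> that u ux uy cont(2,3)] .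
  define g where "g z = Complex (ux z) (- uy z)" for z
  have g: "(g has_field_derivative Complex (uxx z) (- uyx z)) (at z)" if "z \<in> D" for z
  proof -
    have "(g has_derivative (\<lambda>h. Complex (uxx z * Re h + uxy z * Im h) (- (uyx z * Re h + uyy z * Im h)))) (at z)"
      unfolding g_def Complex_eq
      by (intro has_derivative_add has_derivative_mult_right has_derivative_of_real has_derivative_minus ux uy that)
    moreover have "uyy z = - uxx z" using lap[OF that] by linarith
    then have "Complex (uxx z * Re h + uxy z * Im h) (- (uyx z * Re h + uyy z * Im h)) = Complex (uxx z) (- uyx z) * h" for h
      using sym[OF that] \<open>uyy z = - uxx z\<close> by (simp add: complex_eq_iff algebra_simps)
    ultimately show ?thesis by (simp add: has_field_derivative_def)
  qed
  have holg: "g holomorphic_on ?B"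
    using g assms(2) by (meson field_differentiable_at_within field_differentiable_def holomorphic_onI subsetD)
  obtain f0 where f0: "\<And>z. z \<in> ?B \<Longrightarrow> (f0 has_field_derivative g z) (at z within ?B)"
    using holomorphic_convex_primitive'[OF convex_ball open_ball holg] by blast
  define f where "f z = f0 z - f0 z0 + of_real (u z0)" for z
  have f: "(f has_field_derivative g z) (at z)" if "z \<in> ?B" for z
    unfolding f_def using f0[OF that] that at_within_open[OF that open_ball]
    by (auto intro!: derivative_eq_intros)
  have Re_f: "((\<lambda>z. Re (f z)) has_derivative (\<lambda>h. ux z * Re h + uy z * Im h)) (at z)"
   and Im_f: "((\<lambda>z. Im (f z)) has_derivative (\<lambda>h. - uy z * Re h + ux z * Im h)) (at z)" if "z \<in> ?B" for z
    using has_derivative_Re[OF f[OF that, unfolded has_field_derivative_def]]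
      has_derivative_Im[OF f[OF that, unfolded has_field_derivative_def]]
    by (auto simp: g_def algebra_simps)
  have "Re (f z) - u z = Re (f z0) - u z0" if "z \<in> ?B" for z
  proof (rule has_derivative_zero_unique[of ?B "\<lambda>z. Re (f z) - u z"])
    show "((\<lambda>z. Re (f z) - u z) has_derivative (\<lambda>h. 0)) (at x within ?B)" if "x \<in> ?B" for x
      using has_derivative_at_withinI[OF has_derivative_diff[OF Re_f[OF that] u]] that assms(2)
      by auto
  qed (use that R in auto)
  then have Re: "Re (f z) = u z" if "z \<in> ?B" for z using that by (simp add: f_def)
  have "harmonic_on ?B (\<lambda>z. Im (f z))"
    unfolding harmonic_on_def
  proof (intro conjI exI ballI)
    fix z assume "z \<in> ?B"
    then have zD: "z \<in> D" using assms(2) by blast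
    show "((\<lambda>z. Im (f z)) has_derivative (\<lambda>h. (\<lambda>z. - uy z) z * Re h + ux z * Im h)) (at z)"
      using Im_f[OF \<open>z \<in> ?B\<close>] by simp
    show "((\<lambda>z. - uy z) has_derivative (\<lambda>h. (\<lambda>z. - uyx z) z * Re h + (\<lambda>z. - uyy z) z * Im h)) (at z)"
      using has_derivative_minus[OF uy[OF zD]] by simp
    show "(ux has_derivative (\<lambda>h. uxx z * Re h + uxy z * Im h)) (at z)" using ux[OF zD] .
    show "- uyx z + uxy z = 0" using sym[OF zD] by simp
  qed (use cont assms(2) in \<open>auto intro!: continuous_on_minus intro: continuous_on_subset\<close>)
  moreover have "f holomorphic_on ?B"
    using f by (meson field_differentiable_at_within field_differentiable_def holomorphic_onI)
  moreover have "Im (f z0) = 0" by (simp add: f_def)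
  ultimately show ?thesis using that Re by blast
qed

text \<open>A form of the Borel--Caratheodory inequality, by Schwarz' lemma applied to \<open>\<phi> / (4 M - \<phi>)\<close>, where \<open>\<phi> = f - f w\<close>.\<close>

lemma holomorphic_difference_bound:
  assumes hol: "f holomorphic_on ball w r" and r: "r > 0"
    and M: "\<And>z. z \<in> ball w r \<Longrightarrow> \<bar>Re (f z)\<bar> < M"
    and x: "norm (x - w) \<le> r / 2"
  shows "norm (f x - f w) \<le> 8 * M * norm (x - w) / r"
proof -
  define \<phi> where "\<phi> \<zeta> = f (w + of_real r * \<zeta>) - f w" for \<zeta>
  have in_ball: "w + of_real r * \<zeta> \<in> ball w r" if "norm \<zeta> < 1" for \<zeta>
    using that r by (simp add: dist_norm norm_mult)
  have M0: "M > 0" using M[of w] r by simp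
  have hol\<phi>: "\<phi> holomorphic_on ball 0 1"
    unfolding \<phi>_def
    by (intro holomorphic_intros holomorphic_on_compose_gen[OF _ hol, unfolded comp_def])
      (use in_ball in auto)
  have Re\<phi>: "Re (\<phi> \<zeta>) < 2 * M" if "norm \<zeta> < 1" for \<zeta>
    using M[OF in_ball[OF that]] M[of w] r by (simp add: \<phi>_def)
  have nz: "4 * of_real M - \<phi> \<zeta> \<noteq> 0" if "norm \<zeta> < 1" for \<zeta>
  proof
    assume "4 * of_real M - \<phi> \<zeta> = 0"
    then have "\<phi> \<zeta> = 4 * of_real M" by simp
    then have "Re (\<phi> \<zeta>) = 4 * M" by simp
    then show False using Re\<phi>[OF that] M0 by simp
  qed
  \<comment> \<open>\<open>4 * M\<close> is the mirror image of 0 in the line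
    \<open>Re = 2 * M\<close> that bounds the half-plane containing the values of
    \<open>\<phi>\<close>. Points of the half-plane are closer to 0 than to its image, so
    \<open>G\<close> maps into the unit disk.\<close>
  define G where "G \<zeta> = \<phi> \<zeta> / (4 * of_real M - \<phi> \<zeta>)" for \<zeta>
  have G1: "norm (G \<zeta>) < 1" if "norm \<zeta> < 1" for \<zeta>
  proof -
    have "(norm (\<phi> \<zeta>))\<^sup>2 < (norm (4 * of_real M - \<phi> \<zeta>))\<^sup>2"
    proof -
      have "(norm (4 * of_real M - \<phi> \<zeta>))\<^sup>2 - (norm (\<phi> \<zeta>))\<^sup>2 = 8 * M * (2 * M - Re (\<phi> \<zeta>))"
        unfolding cmod_power2 by (simp add: power2_eq_square algebra_simps)
      moreover have "\<dots> > 0" using Re\<phi>[OF that] M0 by simp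
      ultimately show ?thesis by linarith
    qed
    then have "norm (\<phi> \<zeta>) < norm (4 * of_real M - \<phi> \<zeta>)" by (simp add: power2_less_imp_less)
    then show ?thesis using nz[OF that] by (simp add: G_def norm_divide)
  qed
  have \<phi>0: "\<phi> 0 = 0" by (simp add: \<phi>_def)
  have holG: "G holomorphic_on ball 0 1"
    unfolding G_def by (intro holomorphic_intros hol\<phi>) (use nz in auto)
  define \<zeta> where "\<zeta> = (x - w) / of_real r"
  have n\<zeta>: "norm \<zeta> = norm (x - w) / r" using r by (simp add: \<zeta>_def norm_divide)
  then have half: "norm \<zeta> \<le> 1 / 2" using x r unfolding n\<zeta> by (simp add: pos_divide_le_eq)
  then have lt1: "norm \<zeta> < 1" by simp
  have GS: "norm (G \<zeta>) \<le> norm \<zeta>"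
    by (rule Schwarz_Lemma(1)[OF holG]) (use G1 \<phi>0 lt1 in \<open>auto simp: G_def\<close>)
  have "G \<zeta> * (4 * of_real M - \<phi> \<zeta>) = \<phi> \<zeta>" using nz[OF lt1] by (simp add: G_def)
  then have "norm (\<phi> \<zeta>) = norm (G \<zeta>) * norm (4 * of_real M - \<phi> \<zeta>)" by (metis norm_mult)
  also have "\<dots> \<le> norm \<zeta> * (4 * M + norm (\<phi> \<zeta>))"
    using norm_triangle_ineq4[of "4 * of_real M" "\<phi> \<zeta>"] M0 GS
    by (intro mult_mono) (auto simp: norm_mult)
  \<comment> \<open>As \<open>norm \<zeta>\<close> is at most one half, half of
    \<open>norm (\<phi> \<zeta>)\<close> can be absorbed on the left, which doubles 4 to 8.\<close>
  also have "\<dots> \<le> 4 * M * norm \<zeta> + norm (\<phi> \<zeta>) / 2"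
    using mult_right_mono[OF half norm_ge_zero[of "\<phi> \<zeta>"]] by (simp add: algebra_simps)
  finally have "norm (\<phi> \<zeta>) \<le> 8 * M * norm \<zeta>" by simp
  moreover have "\<phi> \<zeta> = f x - f w" using r by (simp add: \<phi>_def \<zeta>_def)
  ultimately show ?thesis by (simp add: n\<zeta>)
qed

text \<open>Taylor's theorem with Cauchy's estimate for the second derivative. A ball of radius
  \<open>r / 4\<close> about a point within \<open>r / 4\<close> of \<open>w\<close> stays within
  \<open>r / 2\<close>, where \<open>f\<close> differs from \<open>f w\<close> by at most
  \<open>4 * M\<close>, strictly less than \<open>5 * M\<close>; hence
  \<open>2 * 5 * 16 = 160\<close>.\<close>

lemma holomorphic_linear_approx:
  assumes hol: "f holomorphic_on ball w r" and r: "r > 0"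
    and M: "\<And>z. z \<in> ball w r \<Longrightarrow> \<bar>Re (f z)\<bar> < M"
    and h: "norm h \<le> r / 4"
  shows "norm (f (w + h) - f w - deriv f w * h) \<le> 160 * M * (norm h)\<^sup>2 / r\<^sup>2"
proof -
  have M0: "M > 0" using M[of w] r by simp
  have bound: "norm ((deriv ^^ 2) f x) \<le> 160 * M / r\<^sup>2" if "x \<in> cball w (r/4)" for x
  proof -
    have sub: "cball x (r / 4) \<subseteq> ball w r"
      using that r by (simp add: cball_subset_ball_iff dist_commute)
    have "norm ((deriv ^^ 2) f x) \<le> fact 2 * (5 * M) / (r / 4)\<^sup>2"
    proof (rule Cauchy_higher_deriv_bound)
      show "f holomorphic_on ball x (r / 4)"
        using hol sub holomorphic_on_subset ball_subset_cball by (metis subset_trans)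
      show "continuous_on (cball x (r / 4)) f"
        using hol sub holomorphic_on_imp_continuous_on continuous_on_subset by blast
      show "f y \<in> ball (f w) (5 * M)" if "y \<in> ball x (r / 4)" for y
      proof -
        have "norm (y - w) \<le> r / 2"
          using that \<open>x \<in> _\<close> dist_triangle[of w y x] by (simp add: dist_norm norm_minus_commute)
        from holomorphic_difference_bound[OF hol r M this]
        have "norm (f y - f w) \<le> 8 * M * norm (y - w) / r" by simp
        also have "\<dots> \<le> 8 * M * (r / 2) / r"
          using \<open>norm (y - w) \<le> r / 2\<close> M0 r by (intro divide_right_mono mult_left_mono) auto
        also have "\<dots> < 5 * M" using r M0 by simp
        finally show ?thesis by (simp add: dist_norm norm_minus_commute)
      qed
    qed (use r in auto)
    then show ?thesis by (simp add: power2_eq_square field_simps)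
  qed
  have sub: "cball w (r / 4) \<subseteq> ball w r" using r by (simp add: cball_subset_ball_iff)
  have D: "((deriv ^^ i) f has_field_derivative (deriv ^^ Suc i) f x) (at x within cball w (r / 4))"
    if "x \<in> cball w (r / 4)" for x i
  proof -
    have "(deriv ^^ i) f holomorphic_on ball w r" by (rule holomorphic_higher_deriv[OF hol]) simp
    then show ?thesis
      using holomorphic_derivI[of _ "ball w r" x] that sub by (auto simp: has_field_derivative_at_within)
  qed
  have "norm ((deriv ^^ 0) f (w + h) - (\<Sum>i\<le>1. (deriv ^^ i) f w * (w + h - w) ^ i / fact i))
      \<le> (160 * M / r\<^sup>2) * norm (w + h - w) ^ Suc 1 / fact 1"
    by (rule complex_Taylor[where f = "\<lambda>i. (deriv ^^ i) f" and S = "cball w (r / 4)"]) (use bound h r D in \<open>auto simp: numeral_2_eq_2 dist_norm\<close>)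
  then show ?thesis by (simp add: algebra_simps power2_eq_square)
qed

text \<open>A discrete Cauchy--Riemann equation.\<close>

lemma conjugate_step:
  assumes hol: "f holomorphic_on ball w r" and r: "r > 0"
    and M: "\<And>z. z \<in> ball w r \<Longrightarrow> \<bar>Re (f z)\<bar> < M"
    and h: "norm h \<le> r / 4"
  shows "\<bar>(Im (f (w + h)) - Im (f w)) - (Re (f w) - Re (f (w + \<i> * h)))\<bar>
      \<le> 320 * M * (norm h)\<^sup>2 / r\<^sup>2"
proof -
  let ?e = "\<lambda>h. f (w + h) - f w - deriv f w * h"
  have 1: "norm (?e h) \<le> 160 * M * (norm h)\<^sup>2 / r\<^sup>2"
    by (rule holomorphic_linear_approx[OF hol r M h])
  have 2: "norm (?e (\<i> * h)) \<le> 160 * M * (norm h)\<^sup>2 / r\<^sup>2"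
    using holomorphic_linear_approx[OF hol r M, of "\<i> * h"] h by (simp add: norm_mult)
  \<comment> \<open>For \<open>a = deriv f w * h\<close> one has
    \<open>Im a + Re (\<i> * a) = 0\<close>: the linear terms cancel and two remainders are
    left.\<close>
  have "(Im (f (w + h)) - Im (f w)) - (Re (f w) - Re (f (w + \<i> * h))) = Im (?e h) + Re (?e (\<i> * h))"
    by (simp add: algebra_simps)
  then show ?thesis
    using abs_Im_le_cmod[of "?e h"] abs_Re_le_cmod[of "?e (\<i> * h)"] 1 2
      abs_triangle_ineq[of "Im (?e h)" "Re (?e (\<i> * h))"] by simp
qed

section \<open>Certificates for values of the conjugate\<close>

definition cpt :: "nat \<Rightarrow> complex" where
  "cpt n = Complex (qdec (p1 n)) (qdec (p2 n))"

lemma cpt_sel [simp]: "Re (cpt n) = qdec (p1 n)" "Im (cpt n) = qdec (p2 n)"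
  by (simp_all add: cpt_def)

lemma cpt_dense: "d > 0 \<Longrightarrow> \<exists>n. \<bar>Re (cpt n) - Re x\<bar> < d \<and> \<bar>Im (cpt n) - Im x\<bar> < d"
  using qdec_dense[of "Re x - d" "Re x + d"] qdec_dense[of "Im x - d" "Im x + d"]
  by (auto simp: abs_less_iff) (metis add.commute less_diff_eq minus_diff_eq neg_less_iff_less p_pr(1,2) diff_less_eq)

text \<open>The oracle \<open>g\<close> is \<open>join2 X p\<close>, where \<open>X\<close> is the graph of the joined data; \<open>named g m k\<close>
  states that the entry \<open>m\<close> of the data is \<open>k\<close>.\<close>

definition named :: "(nat \<Rightarrow> nat) \<Rightarrow> nat \<Rightarrow> nat \<Rightarrow> bool" where
  "named g m k \<longleftrightarrow> g (pr 0 (pr m k)) = 1"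

text \<open>The oracle presented to the machine for \<open>u\<close>: its oracle set, and a finite initial segment
  \<open>s\<close> of the name of a point.\<close>

definition u_oracle :: "(nat \<Rightarrow> nat) \<Rightarrow> nat \<Rightarrow> nat \<Rightarrow> nat \<Rightarrow> bool" where
  "u_oracle g s a y \<longleftrightarrow>
     p1 a = 0 \<and> (\<exists>k. named g (pr 0 (Suc (p2 a))) k \<and> (k \<noteq> 0 \<and> y = 1 \<or> k = 0 \<and> y = 0)) \<or>
     p1 a \<noteq> 0 \<and> p2 a < llen s \<and> lnth s (p2 a) = y"

text \<open>\<open>pr 0 0\<close> addresses entry 0 of the name of \<open>u\<close>, the code of its
  machine, and \<open>Suc (pr m 0)\<close> codes the input list \<open>[m]\<close>.\<close>

definition value_bound :: "(nat \<Rightarrow> nat) \<Rightarrow> nat \<Rightarrow> nat \<Rightarrow> bool" where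
  "value_bound g s k \<longleftrightarrow> (\<exists>m c. named g (pr 0 0) c \<and>
     derivable (ev_rule (u_oracle g s)) (pr c (pr (Suc (pr m 0)) k)))"

text \<open>\<open>incl w r n\<close> is a decidable sufficient condition for the square of half-width \<open>r\<close> centred at \<open>w\<close>
  to lie in \<open>basic n\<close>. For radius \<open>qdec (p2 n) \<le> 0\<close> the outer basic set is the whole sphere.\<close>

definition incl :: "complex \<Rightarrow> real \<Rightarrow> nat \<Rightarrow> bool" where
  "incl w r n \<longleftrightarrow>
     p1 n = 0 \<and> qdec (p1 (p2 n)) < Re w - r \<and> Re w + r < qdec (p1 (p2 (p2 n))) \<and>
       qdec (p1 (p2 (p2 (p2 n)))) < Im w - r \<and> Im w + r < qdec (p2 (p2 (p2 (p2 n)))) \<or>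
     p1 n \<noteq> 0 \<and> (qdec (p2 n) \<le> 0 \<or>
       (qdec (p2 n) + 2 * r) * (qdec (p2 n) + 2 * r) < Re w * Re w + Im w * Im w)"

text \<open>Used with \<open>r > 0\<close> for a uniform bound on a square and with
  \<open>r = 0\<close> to approximate a single value of \<open>u\<close>.\<close>

definition u_between :: "(nat \<Rightarrow> nat) \<Rightarrow> complex \<Rightarrow> real \<Rightarrow> real \<Rightarrow> real \<Rightarrow> bool" where
  "u_between g w r c d \<longleftrightarrow> (\<exists>s k. value_bound g s k \<and> c \<le> qdec (p1 k) \<and> qdec (p2 k) \<le> d \<and>
     (\<forall>i<llen s. incl w r (lnth s i)))"

text \<open>A finite certificate of closeness: the named point lies in the listed rectangle
  \<open>n\<close>, which is contained in the square of half-width \<open>d\<close> about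
  \<open>c\<close>.\<close>

definition near :: "(nat \<Rightarrow> bool) \<Rightarrow> complex \<Rightarrow> real \<Rightarrow> bool" where
  "near N c d \<longleftrightarrow> (\<exists>n. N n \<and> p1 n = 0 \<and>
     Re c - d \<le> qdec (p1 (p2 n)) \<and> qdec (p1 (p2 (p2 n))) \<le> Re c + d \<and>
     Im c - d \<le> qdec (p1 (p2 (p2 (p2 n)))) \<and> qdec (p2 (p2 (p2 (p2 n)))) \<le> Im c + d)"

definition centre_name :: "(nat \<Rightarrow> nat) \<Rightarrow> nat \<Rightarrow> bool" where
  "centre_name g n \<longleftrightarrow> (\<exists>m. named g (pr 1 m) n)"

text \<open>The name of the point is read directly from the function part of \<open>join2\<close>,
  whereas the centre is accessible only through the graph in the set part.\<close>

definition point_name :: "(nat \<Rightarrow> nat) \<Rightarrow> nat \<Rightarrow> bool" where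
  "point_name g n \<longleftrightarrow> (\<exists>m. g (pr 1 m) = n)"

text \<open>Squared form of \<open>dist w c + 2 * r + 2 * d < q\<close>, with
  \<open>q = qdec (p1 k)\<close> a lower bound of the radius. The term \<open>2 * d\<close> allows
  for the distance from the rational centre to the true one, \<open>2 * r\<close> for the square
  about \<open>w\<close>.\<close>

definition in_disc :: "(nat \<Rightarrow> nat) \<Rightarrow> complex \<Rightarrow> real \<Rightarrow> bool" where
  "in_disc g w r \<longleftrightarrow> (\<exists>c d l k. near (centre_name g) (cpt c) (qdec d) \<and> named g (pr 2 l) k \<and>
     0 < qdec (p1 k) - 2 * r - 2 * qdec d \<and>
     (Re w - qdec (p1 c)) * (Re w - qdec (p1 c)) + (Im w - qdec (p2 c)) * (Im w - qdec (p2 c))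
      < (qdec (p1 k) - 2 * r - 2 * qdec d) * (qdec (p1 k) - 2 * r - 2 * qdec d))"

definition u_bounded :: "(nat \<Rightarrow> nat) \<Rightarrow> complex \<Rightarrow> real \<Rightarrow> real \<Rightarrow> bool" where
  "u_bounded g w r M \<longleftrightarrow> 0 < r \<and> in_disc g w r \<and> u_between g w r (- M) M"

text \<open>The conjugate vanishes at the centre, so by \<open>u_bounded_near\<close> its value at
  \<open>w\<close> is at most \<open>16 * M * d / r\<close> in modulus; the inequalities are
  multiplied by \<open>r\<close>.\<close>

definition chain_start :: "(nat \<Rightarrow> nat) \<Rightarrow> complex \<Rightarrow> real \<Rightarrow> real \<Rightarrow> bool" where
  "chain_start g w a b \<longleftrightarrow> (\<exists>r M d. u_bounded g w (qdec r) (qdec M) \<and>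
     near (centre_name g) w (qdec d) \<and> 4 * qdec d \<le> qdec r \<and>
     a * qdec r \<le> - (16 * qdec M * qdec d) \<and> 16 * qdec M * qdec d \<le> b * qdec r)"

text \<open>The inequalities make the interval \<open>[a', b']\<close> contain \<open>v w'\<close> whenever \<open>[a, b]\<close> contains \<open>v w\<close>, by
  \<open>conjugate_step\<close> with \<open>h = w' - w\<close>.\<close>

definition chain_step :: "(nat \<Rightarrow> nat) \<Rightarrow> complex \<Rightarrow> real \<Rightarrow> real \<Rightarrow> complex \<Rightarrow> real \<Rightarrow> real \<Rightarrow> bool" where
  "chain_step g w a b w' a' b' \<longleftrightarrow> (\<exists>r M e c1 c2 d1 d2. u_bounded g w (qdec r) (qdec M) \<and>
     (Re w' - Re w) * (Re w' - Re w) + (Im w' - Im w) * (Im w' - Im w) \<le> qdec e * qdec e \<and>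
     0 < qdec e \<and> 4 * qdec e \<le> qdec r \<and>
     u_between g w 0 (qdec c1) (qdec c2) \<and>
     u_between g (Complex (Re w - (Im w' - Im w)) (Im w + (Re w' - Re w))) 0 (qdec d1) (qdec d2) \<and>
     (a' - a - (qdec c1 - qdec d2)) * (qdec r * qdec r) \<le> - (320 * qdec M * (qdec e * qdec e)) \<and>
     320 * qdec M * (qdec e * qdec e) \<le> (b' - b - (qdec c2 - qdec d1)) * (qdec r * qdec r))"

text \<open>A derived number \<open>pr w (pr a b)\<close> stands for the assertion that the
  conjugate at \<open>cpt w\<close> lies in \<open>[qdec a, qdec b]\<close>.\<close>

definition chain_rule :: "(nat \<Rightarrow> nat) \<Rightarrow> nat \<Rightarrow> nat set \<Rightarrow> bool" where
  "chain_rule g x S \<longleftrightarrow>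
     chain_start g (cpt (p1 x)) (qdec (p1 (p2 x))) (qdec (p2 (p2 x))) \<or>
     (\<exists>y. y \<in> S \<and> chain_step g (cpt (p1 y)) (qdec (p1 (p2 y))) (qdec (p2 (p2 y)))
        (cpt (p1 x)) (qdec (p1 (p2 x))) (qdec (p2 (p2 x))))"

text \<open>The last link leads from a rational chain point to the point known only by its name,
  with the same estimate as in \<open>chain_start\<close>. The inequalities are strict because
  \<open>rbasic\<close> intervals are open.\<close>

definition conjugate_in :: "(nat \<Rightarrow> nat) \<Rightarrow> nat \<Rightarrow> bool" where
  "conjugate_in g n \<longleftrightarrow> (\<exists>x r M d. derivable (chain_rule g) x \<and>
     u_bounded g (cpt (p1 x)) (qdec r) (qdec M) \<and>
     near (point_name g) (cpt (p1 x)) (qdec d) \<and> 4 * qdec d \<le> qdec r \<and>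
     16 * qdec M * qdec d < (qdec (p1 (p2 x)) - qdec (p1 n)) * qdec r \<and>
     16 * qdec M * qdec d < (qdec (p2 n) - qdec (p2 (p2 x))) * qdec r)"

subsection \<open>Enumerability\<close>

lemma rq_comp: "rq T \<Longrightarrow> rc G \<Longrightarrow> rq (\<lambda>g x. T g (G g x))"
  unfolding rq_def[of T]
proof (elim exE conjE)
  fix P N D assume "rc P" "rc N" "rc D" "rc G"
    "\<forall>g x. 0 < D g x \<and> T g x = (real (P g x) - real (N g x)) / real (D g x)"
  then show ?thesis
    by (intro rqI[of "\<lambda>g x. P g (G g x)" "\<lambda>g x. N g (G g x)" "\<lambda>g x. D g (G g x)"])
      (auto intro: rc_comp)
qed

lemma ce_named [ce_intros]: "rc m \<Longrightarrow> rc k \<Longrightarrow> ce (\<lambda>g x. named g (m g x) (k g x))"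
  unfolding named_def by (intro ce_intros rc_intros)

lemma ce_value_bound [ce_intros]:
  assumes "rc s" "rc k" shows "ce (\<lambda>g x. value_bound g (s g x) (k g x))"
proof -
  have "ce (\<lambda>g w. u_oracle g (p1 w) (p1 (p2 w)) (p2 (p2 w)))"
    unfolding u_oracle_def by (intro ce_intros rc_intros)
  note ev = ce_ev_rule[of u_oracle, OF this]
  show ?thesis
    unfolding value_bound_def by (intro ce_intros rc_intros ev rc_comp[OF assms(1)] rc_comp[OF assms(2)])
qed

lemma ce_incl [ce_intros]:
  assumes "rq (\<lambda>g x. Re (w g x))" "rq (\<lambda>g x. Im (w g x))" "rq r" "rc n"
  shows "ce (\<lambda>g x. incl (w g x) (r g x) (n g x))"
  unfolding incl_def by (intro ce_intros rc_intros rq_intros assms)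

lemma ce_u_between [ce_intros]:
  assumes "rq (\<lambda>g x. Re (w g x))" "rq (\<lambda>g x. Im (w g x))" "rq r" "rq c" "rq d"
  shows "ce (\<lambda>g x. u_between g (w g x) (r g x) (c g x) (d g x))"
  unfolding u_between_def by (intro ce_intros rc_intros rq_intros assms[THEN rq_comp])

lemma ce_near [ce_intros]:
  assumes "ce N" "rq (\<lambda>g x. Re (c g x))" "rq (\<lambda>g x. Im (c g x))" "rq d"
  shows "ce (\<lambda>g x. near (N g) (c g x) (d g x))"
  unfolding near_def by (intro ce_intros rc_intros rq_intros ce_comp[OF assms(1)] assms(2-4)[THEN rq_comp])

lemma ce_centre_name [ce_intros]: "ce centre_name"
  unfolding centre_name_def by (intro ce_intros rc_intros)

lemma ce_point_name [ce_intros]: "ce point_name"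
  unfolding point_name_def by (intro ce_intros rc_intros)

lemma rq_cpt [rq_intros]:
  assumes "rc n" shows "rq (\<lambda>g x. Re (cpt (n g x)))" "rq (\<lambda>g x. Im (cpt (n g x)))"
  unfolding cpt_sel by (intro rq_intros rc_intros assms)+

lemma rq_Complex [rq_intros]:
  "rq a \<Longrightarrow> rq (\<lambda>g x. Re (Complex (a g x) (b g x)))"
  "rq b \<Longrightarrow> rq (\<lambda>g x. Im (Complex (a g x) (b g x)))"
  by simp_all

lemma ce_in_disc [ce_intros]:
  assumes "rq (\<lambda>g x. Re (w g x))" "rq (\<lambda>g x. Im (w g x))" "rq r"
  shows "ce (\<lambda>g x. in_disc g (w g x) (r g x))"
  unfolding in_disc_def by (intro ce_intros rc_intros rq_intros assms[THEN rq_comp])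

lemma ce_u_bounded [ce_intros]:
  assumes "rq (\<lambda>g x. Re (w g x))" "rq (\<lambda>g x. Im (w g x))" "rq r" "rq M"
  shows "ce (\<lambda>g x. u_bounded g (w g x) (r g x) (M g x))"
  unfolding u_bounded_def by (intro ce_intros rq_intros assms)

lemma ce_chain_start [ce_intros]:
  assumes "rq (\<lambda>g x. Re (w g x))" "rq (\<lambda>g x. Im (w g x))" "rq a" "rq b"
  shows "ce (\<lambda>g x. chain_start g (w g x) (a g x) (b g x))"
  unfolding chain_start_def by (intro ce_intros rc_intros rq_intros assms[THEN rq_comp])

lemma ce_chain_step [ce_intros]:
  assumes "rq (\<lambda>g x. Re (w g x))" "rq (\<lambda>g x. Im (w g x))" "rq a" "rq b"
    "rq (\<lambda>g x. Re (w' g x))" "rq (\<lambda>g x. Im (w' g x))" "rq a'" "rq b'"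
  shows "ce (\<lambda>g x. chain_step g (w g x) (a g x) (b g x) (w' g x) (a' g x) (b' g x))"
  unfolding chain_step_def by (intro ce_intros rc_intros rq_intros assms[THEN rq_comp])

lemma ce_conjugate_in: "ce conjugate_in"
proof -
  have "ce (\<lambda>g w. chain_rule g (p1 (p2 w)) (set (list_decode (p2 (p2 w)))))"
    unfolding chain_rule_def by (intro ce_intros rc_intros rq_intros)
  note chain = ce_derivable[of "\<lambda>g a. chain_rule g", OF this rc_const]
  show ?thesis
    unfolding conjugate_in_def by (intro ce_intros rc_intros rq_intros chain)
qed

subsection \<open>Soundness\<close>

lemma basic_iff: "Some x \<in> basic n \<longleftrightarrow>
   (if p1 n = 0 then qdec (p1 (p2 n)) < Re x \<and> Re x < qdec (p1 (p2 (p2 n))) \<and>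
      qdec (p1 (p2 (p2 (p2 n)))) < Im x \<and> Im x < qdec (p2 (p2 (p2 (p2 n))))
    else qdec (p2 n) \<le> 0 \<or> qdec (p2 n) < norm x)"
proof (cases "p1 n = 0")
  case True
  then show ?thesis
    by (auto simp: basic_def p1_def p2_def in_box_complex_iff split: prod.splits)
next
  case False
  have "closure (ball 0 q) = (if q \<le> 0 then {} else cball (0 :: complex) q)" for q :: real by auto
  then show ?thesis using False
    by (auto simp: basic_def p1_def p2_def not_le split: prod.splits)
qed

text \<open>For outer sets, the square lies in the closed ball of radius \<open>2 * r\<close> about
  \<open>w\<close>, since the norm is at most the sum of the coordinate distances; this explains the
  \<open>2 * r\<close> in \<open>incl\<close>.\<close>

lemma incl_sound:
  assumes "incl w r n" "\<bar>Re x - Re w\<bar> \<le> r" "\<bar>Im x - Im w\<bar> \<le> r"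
  shows "Some x \<in> basic n"
proof (cases "p1 n = 0")
  case True
  then show ?thesis using assms by (auto simp: incl_def basic_iff)
next
  case False
  have "qdec (p2 n) < norm x" if q: "qdec (p2 n) > 0"
    and *: "(qdec (p2 n) + 2 * r) * (qdec (p2 n) + 2 * r) < Re w * Re w + Im w * Im w"
  proof -
    have "(qdec (p2 n) + 2 * r)\<^sup>2 < (norm w)\<^sup>2"
      using * unfolding cmod_power2 by (simp add: power2_eq_square)
    then have "qdec (p2 n) + 2 * r < norm w" by (rule power2_less_imp_less) simp
    moreover have "norm (x - w) \<le> 2 * r" using cmod_le[of "x - w"] assms(2,3) by simp
    ultimately show ?thesis using norm_triangle_sub[of w x] by (simp add: norm_minus_commute)
  qed
  then show ?thesis using False assms(1) not_less by (auto simp: incl_def basic_iff)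
qed

text \<open>The condition is open jointly in centre and half-width and holds at
  \<open>(x, 0)\<close>, so it extends to nearby centres and small positive half-widths.\<close>

lemma incl_complete:
  assumes "Some x \<in> basic n"
  shows "\<forall>\<^sub>F q in nhds (x, 0). incl (fst q) (snd q) n"
proof -
  have "open {q :: complex \<times> real. incl (fst q) (snd q) n}"
    unfolding incl_def
    by (intro open_Collect_disj open_Collect_conj open_Collect_const open_Collect_less continuous_intros)
  moreover have "incl x 0 n"
  proof (cases "p1 n = 0 \<or> qdec (p2 n) \<le> 0")
    case True then show ?thesis using assms by (auto simp: incl_def basic_iff)
  next
    case False
    then have "qdec (p2 n) < norm x" "qdec (p2 n) > 0" using assms by (auto simp: basic_iff split: if_splits)
    then have "(qdec (p2 n))\<^sup>2 < (norm x)\<^sup>2" by (intro power_strict_mono) auto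
    then show ?thesis using False unfolding cmod_power2 by (simp add: incl_def power2_eq_square)
  qed
  ultimately show ?thesis unfolding eventually_nhds by (intro exI[of _ "{q. incl (fst q) (snd q) n}"]) auto
qed

lemma near_sound:
  assumes "near N c d" "\<And>n. N n \<Longrightarrow> Some x \<in> basic n"
  shows "\<bar>Re x - Re c\<bar> < d \<and> \<bar>Im x - Im c\<bar> < d"
proof -
  obtain n where n: "N n" "p1 n = 0"
    "Re c - d \<le> qdec (p1 (p2 n))" "qdec (p1 (p2 (p2 n))) \<le> Re c + d"
    "Im c - d \<le> qdec (p1 (p2 (p2 (p2 n))))" "qdec (p2 (p2 (p2 (p2 n)))) \<le> Im c + d"
    using assms(1) unfolding near_def by blast
  then show ?thesis using assms(2)[OF n(1)] by (auto simp: basic_iff)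
qed

lemma near_complete:
  assumes "\<bar>Re x - Re c\<bar> < d" "\<bar>Im x - Im c\<bar> < d" "\<And>n. Some x \<in> basic n \<Longrightarrow> N n"
  shows "near N c d"
proof -
  obtain a1 a2 b1 b2 where
    "Re c - d < qdec a1" "qdec a1 < Re x" "Re x < qdec a2" "qdec a2 < Re c + d"
    "Im c - d < qdec b1" "qdec b1 < Im x" "Im x < qdec b2" "qdec b2 < Im c + d"
    using qdec_dense[of "Re c - d" "Re x"] qdec_dense[of "Re x" "Re c + d"]
      qdec_dense[of "Im c - d" "Im x"] qdec_dense[of "Im x" "Im c + d"] assms(1,2)
    by (auto simp: abs_less_iff algebra_simps)
  then show ?thesis
    unfolding near_def
    by (intro exI[of _ "pr 0 (pr a1 (pr a2 (pr b1 b2)))"]) (auto simp: basic_iff intro!: assms(3))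
qed

text \<open>A name lists its sets in any order and with repetitions, so any finite list of basic
  sets around \<open>x\<close> is the beginning of some name.\<close>

lemma ex_cname: "\<exists>p. cname (Some x) p \<and> (\<forall>i<llen s. p i = lnth s i)"
  if "\<forall>i<llen s. Some x \<in> basic (lnth s i)"
proof -
  \<comment> \<open>The outer set of radius 0 is the whole sphere; its code fills the positions
    whose own number would be inadmissible.\<close>
  have n0: "Some x \<in> basic (pr 1 (pr (int_encode 0) 0))"
    by (simp add: basic_iff qdec_of_int)
  define p where "p i = (if i < llen s then lnth s i else
      if Some x \<in> basic (i - llen s) then i - llen s else pr 1 (pr (int_encode 0) 0))" for i
  have "range p = {n. Some x \<in> basic n}"
  proof (intro set_eqI iffI)
    fix n assume "n \<in> range p"
    then show "n \<in> {n. Some x \<in> basic n}" using that n0 by (auto simp: p_def)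
  next
    fix n assume "n \<in> {n. Some x \<in> basic n}"
    then have "p (llen s + n) = n" by (simp add: p_def)
    then show "n \<in> range p" by (metis rangeI)
  qed
  then show ?thesis by (intro exI[of _ p]) (simp add: cname_def p_def)
qed

lemma ex_eq_iff_range: "range q = {n. P n} \<Longrightarrow> (\<exists>m. q m = n) \<longleftrightarrow> P n"
  by (metis mem_Collect_eq rangeE rangeI)

locale conjugation =
  fixes D :: "csphere set" and u :: "csphere \<Rightarrow> real" and pu pz pR p :: "nat \<Rightarrow> nat"
    and z0 z :: complex and R :: real and f :: "complex \<Rightarrow> complex" and e :: rf
    and g :: "nat \<Rightarrow> nat"
  assumes pu0: "pu 0 = enc e" and u_realized: "realizes e {n. pu (Suc n) \<noteq> 0} D u"
    and z0_name: "cname (Some z0) pz" and R_name: "rname R pR"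
    and ball_D: "Some ` ball z0 R \<subseteq> D"
    and z: "z \<in> ball z0 R" and z_name: "cname (Some z) p"
    and hol_f: "f holomorphic_on ball z0 R"
    and Re_f: "\<And>x. x \<in> ball z0 R \<Longrightarrow> Re (f x) = u (Some x)" and Im_f: "Im (f z0) = 0"
    and g: "g = join2 {n. join3 pu pz pR (p1 n) = p2 n} p"
begin

lemma named_iff: "named g m k \<longleftrightarrow> join3 pu pz pR m = k"
  by (simp add: named_def g join2_def)

lemma named_simps [simp]:
  "named g (pr 0 m) k \<longleftrightarrow> pu m = k" "named g (pr 1 m) k \<longleftrightarrow> pz m = k"
  "named g (pr 2 m) k \<longleftrightarrow> pR m = k"
  by (simp_all add: named_iff join3_def)

lemma centre_name_iff: "centre_name g n \<longleftrightarrow> Some z0 \<in> basic n"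
  using z0_name unfolding centre_name_def cname_def by (simp add: ex_eq_iff_range del: One_nat_def)

lemma point_name_iff: "point_name g n \<longleftrightarrow> Some z \<in> basic n"
  using z_name unfolding point_name_def cname_def by (simp add: g join2_def ex_eq_iff_range)

lemma R_named: "R \<in> rbasic k \<longleftrightarrow> (\<exists>l. named g (pr 2 l) k)"
  using R_name unfolding rname_def by (simp add: ex_eq_iff_range)

lemma u_oracle_iff: "u_oracle g s a y \<longleftrightarrow>
     p1 a = 0 \<and> y = (if p2 a \<in> {n. pu (Suc n) \<noteq> 0} then 1 else 0) \<or>
     p1 a \<noteq> 0 \<and> p2 a < llen s \<and> lnth s (p2 a) = y"
  unfolding u_oracle_def by auto

lemma join2_eq: "join2 X q a = (if p1 a = 0 then if p2 a \<in> X then 1 else 0 else q (p2 a))"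
  by (simp add: join2_def p1_def p2_def split: prod.splits)

text \<open>The prefix \<open>s\<close> extends to a full name of \<open>x\<close>. The simulated
  run is then a genuine run, and by determinism \<open>k\<close> is an entry of a name of
  \<open>u (Some x)\<close>.\<close>

lemma value_bound_sound:
  assumes "value_bound g s k" "Some x \<in> D" "\<forall>i<llen s. Some x \<in> basic (lnth s i)"
  shows "u (Some x) \<in> rbasic k"
proof -
  obtain m where m: "derivable (ev_rule (u_oracle g s)) (pr (enc e) (pr (Suc (pr m 0)) k))"
    using assms(1) pu0 unfolding value_bound_def by auto
  obtain q where q: "cname (Some x) q" "\<forall>i<llen s. q i = lnth s i" using ex_cname[OF assms(3)] by blast
  let ?h = "join2 {n. pu (Suc n) \<noteq> 0} q"
  have "?h a = y" if "u_oracle g s a y" for a y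
    using that q(2) unfolding u_oracle_iff join2_eq by auto
  from ev_rule_sound[OF this m] have ev: "eval e ?h [m] k" by auto
  obtain y where "writes e ?h y" "rname (u (Some x)) y"
    using u_realized assms(2) q(1) unfolding realizes_def by blast
  moreover from this have "y m = k" using ev eval_det unfolding writes_def by blast
  ultimately show ?thesis unfolding rname_def by blast
qed

text \<open>For an arbitrary name of \<open>x\<close>, the machine lists \<open>k\<close> at some
  index \<open>m\<close>; the run on \<open>m\<close> reads only a finite prefix of that
  name.\<close>

lemma value_bound_complete:
  assumes "Some x \<in> D" "u (Some x) \<in> rbasic k"
  shows "\<exists>s. value_bound g s k \<and> (\<forall>i<llen s. Some x \<in> basic (lnth s i))"
proof -
  obtain q where q: "cname (Some x) q" using ex_cname[of 0 x] by (auto simp: llen_def)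
  let ?h = "join2 {n. pu (Suc n) \<noteq> 0} q"
  obtain y where y: "writes e ?h y" "rname (u (Some x)) y"
    using u_realized assms(1) q unfolding realizes_def by blast
  obtain m where m: "y m = k" using y(2) assms(2) ex_eq_iff_range[of y "\<lambda>n. u (Some x) \<in> rbasic n" k] unfolding rname_def by blast
  let ?s = "\<lambda>n. list_encode (map q [0..<n])"
  have "\<exists>n. derivable (ev_rule (u_oracle g (?s n))) (ev_code e [m] k)"
  proof (rule ev_rule_complete[where Qr = "\<lambda>n. u_oracle g (?s n)" and g = ?h])
    show "u_oracle g (?s n') a y" if "n \<le> n'" "u_oracle g (?s n) a y" for n n' a y
      using that unfolding u_oracle_iff by auto
    show "eval e ?h [m] k" using y(1) m unfolding writes_def by blast
    show "\<exists>n. u_oracle g (?s n) a (?h a)" for a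
      \<comment> \<open>A prefix of length \<open>Suc (p2 a)\<close> contains the queried
        entry.\<close>
      unfolding u_oracle_iff join2_eq by (intro exI[of _ "Suc (p2 a)"]) (auto simp del: upt_Suc)
  qed
  then obtain n where n: "derivable (ev_rule (u_oracle g (?s n))) (ev_code e [m] k)" by blast
  have "value_bound g (?s n) k"
    unfolding value_bound_def using n pu0 by (intro exI[of _ m] exI[of _ "enc e"]) simp
  moreover have "\<forall>i<llen (?s n). Some x \<in> basic (lnth (?s n) i)"
    using q unfolding cname_def by auto
  ultimately show ?thesis by blast
qed

lemma u_between_sound:
  assumes "u_between g w r c d" "Some x \<in> D" "\<bar>Re x - Re w\<bar> \<le> r" "\<bar>Im x - Im w\<bar> \<le> r"
  shows "c < u (Some x) \<and> u (Some x) < d"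
proof -
  obtain s k where *: "value_bound g s k" "c \<le> qdec (p1 k)" "qdec (p2 k) \<le> d"
     "\<forall>i<llen s. incl w r (lnth s i)"
    using assms(1) unfolding u_between_def by blast
  have "u (Some x) \<in> rbasic k"
    using value_bound_sound[OF *(1) assms(2)] incl_sound[OF _ assms(3,4)] *(4) by blast
  then show ?thesis using * by (auto simp: rbasic_iff)
qed

lemma u_between_complete:
  assumes "Some x \<in> D" "c < u (Some x)" "u (Some x) < d"
  shows "\<forall>\<^sub>F q in nhds (x, 0). u_between g (fst q) (snd q) c d"
proof -
  obtain a b where ab: "c < qdec a" "qdec a < u (Some x)" "u (Some x) < qdec b" "qdec b < d"
    using assms qdec_dense by metis
  then obtain s where s: "value_bound g s (pr a b)" "\<forall>i<llen s. Some x \<in> basic (lnth s i)"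
    using value_bound_complete[of x "pr a b"] assms(1) by (auto simp: rbasic_iff)
  have "\<forall>\<^sub>F q in nhds (x, 0). \<forall>i\<in>{..<llen s}. incl (fst q) (snd q) (lnth s i)"
    using s(2) by (intro eventually_ball_finite) (auto intro: incl_complete)
  then show ?thesis
    by eventually_elim (use s(1) ab in \<open>force simp: u_between_def\<close>)
qed

lemma norm_le_of_box: "\<bar>Re x - Re w\<bar> \<le> r \<Longrightarrow> \<bar>Im x - Im w\<bar> \<le> r \<Longrightarrow> norm (x - w) \<le> 2 * r"
  for x w :: complex
  using cmod_le[of "x - w"] by simp

lemma in_disc_sound:
  assumes "in_disc g w r" "\<bar>Re x - Re w\<bar> \<le> r" "\<bar>Im x - Im w\<bar> \<le> r"
  shows "x \<in> ball z0 R"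
proof -
  obtain c d k where *: "near (centre_name g) (cpt c) (qdec d)" "R \<in> rbasic k"
     "0 < qdec (p1 k) - 2 * r - 2 * qdec d"
     "(Re w - qdec (p1 c)) * (Re w - qdec (p1 c)) + (Im w - qdec (p2 c)) * (Im w - qdec (p2 c))
      < (qdec (p1 k) - 2 * r - 2 * qdec d) * (qdec (p1 k) - 2 * r - 2 * qdec d)"
    using assms(1) unfolding in_disc_def R_named by blast
  have "(norm (w - cpt c))\<^sup>2 < (qdec (p1 k) - 2 * r - 2 * qdec d)\<^sup>2"
    using *(4) unfolding cmod_power2 by (simp add: power2_eq_square)
  then have "norm (w - cpt c) < qdec (p1 k) - 2 * r - 2 * qdec d"
    by (rule power2_less_imp_less) (use *(3) in simp)
  moreover have "norm (x - w) \<le> 2 * r" using assms(2,3) by (rule norm_le_of_box)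
  moreover have "norm (z0 - cpt c) \<le> 2 * qdec d"
    using near_sound[OF *(1), of z0] centre_name_iff by (intro norm_le_of_box) auto
  moreover have "norm (x - z0) \<le> norm (x - w) + norm (w - cpt c) + norm (z0 - cpt c)"
    using norm_triangle_ineq[of "x - w" "w - cpt c"] norm_triangle_ineq4[of "x - cpt c" "z0 - cpt c"]
    by simp
  moreover have "qdec (p1 k) < R" using *(2) by (simp add: rbasic_iff)
  ultimately show ?thesis by (simp add: dist_norm norm_minus_commute)
qed

lemma in_disc_complete:
  assumes "x \<in> ball z0 R"
  shows "\<forall>\<^sub>F q in nhds (x, 0). in_disc g (fst q) (snd q)"
proof -
  have "norm (x - z0) < R" using assms by (simp add: dist_norm norm_minus_commute)
  then obtain \<rho> \<rho>' where \<rho>: "norm (x - z0) < qdec \<rho>" "qdec \<rho> < R" "R < qdec \<rho>'"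
    using qdec_dense[of "norm (x - z0)" R] qdec_dense[of R "R + 1"] by auto
  then obtain l where l: "named g (pr 2 l) (pr \<rho> \<rho>')"
    using R_named[of "pr \<rho> \<rho>'"] by (auto simp: rbasic_iff)
  \<comment> \<open>The factor 4 pays \<open>2 * qdec d\<close> for the distance from
    \<open>cpt c\<close> to \<open>z0\<close> and \<open>2 * qdec d\<close> for the margin in
    \<open>in_disc\<close>.\<close>
  obtain d where d: "0 < qdec d" "4 * qdec d < qdec \<rho> - norm (x - z0)"
    using qdec_dense[of 0 "(qdec \<rho> - norm (x - z0)) / 4"] \<rho> by auto
  obtain c where c: "\<bar>Re (cpt c) - Re z0\<bar> < qdec d" "\<bar>Im (cpt c) - Im z0\<bar> < qdec d"
    using cpt_dense[OF d(1)] by blast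
  have near: "near (centre_name g) (cpt c) (qdec d)"
    using near_complete[of z0 "cpt c" "qdec d"] c centre_name_iff by (simp add: abs_minus_commute)
  let ?P = "\<lambda>w r. 0 < qdec \<rho> - 2 * r - 2 * qdec d \<and>
     (Re w - qdec (p1 c)) * (Re w - qdec (p1 c)) + (Im w - qdec (p2 c)) * (Im w - qdec (p2 c))
      < (qdec \<rho> - 2 * r - 2 * qdec d) * (qdec \<rho> - 2 * r - 2 * qdec d)"
  have "open {q :: complex \<times> real. ?P (fst q) (snd q)}"
    by (intro open_Collect_conj open_Collect_less continuous_intros)
  moreover have "?P x 0"
  proof -
    have "norm (cpt c - z0) \<le> 2 * qdec d" using c by (intro norm_le_of_box) auto
    then have "norm (x - cpt c) < qdec \<rho> - 2 * qdec d"
      using norm_triangle_ineq4[of "x - z0" "cpt c - z0"] d by simp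
    then have "(norm (x - cpt c))\<^sup>2 < (qdec \<rho> - 2 * qdec d)\<^sup>2"
      by (intro power_strict_mono) auto
    moreover have "0 < qdec \<rho> - 2 * qdec d"
      using \<open>norm (x - cpt c) < _\<close> norm_ge_zero[of "x - cpt c"] by linarith
    ultimately show ?thesis unfolding cmod_power2 by (simp add: power2_eq_square)
  qed
  ultimately have "\<forall>\<^sub>F q in nhds (x, 0). ?P (fst q) (snd q)"
    unfolding eventually_nhds by (intro exI[of _ "{q. ?P (fst q) (snd q)}"]) auto
  then show ?thesis
    by eventually_elim (use near l in \<open>unfold in_disc_def, intro exI[of _ c] exI[of _ d] exI[of _ l] exI[of _ "pr \<rho> \<rho>'"], simp\<close>)
qed

lemma u_bounded_sound:
  assumes "u_bounded g w r M"
  shows "r > 0" "\<And>x. \<bar>Re x - Re w\<bar> \<le> r \<Longrightarrow> \<bar>Im x - Im w\<bar> \<le> r \<Longrightarrow> x \<in> ball z0 R"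
    "w \<in> ball z0 R" "f holomorphic_on ball w r" "\<And>x. x \<in> ball w r \<Longrightarrow> \<bar>Re (f x)\<bar> < M"
proof -
  show r: "r > 0" using assms by (simp add: u_bounded_def)
  show box: "x \<in> ball z0 R" if "\<bar>Re x - Re w\<bar> \<le> r" "\<bar>Im x - Im w\<bar> \<le> r" for x
    using assms that in_disc_sound unfolding u_bounded_def by blast
  have ball: "\<bar>Re x - Re w\<bar> \<le> r" "\<bar>Im x - Im w\<bar> \<le> r" if "x \<in> ball w r" for x
    using that abs_Re_le_cmod[of "x - w"] abs_Im_le_cmod[of "x - w"]
    by (simp_all add: dist_norm norm_minus_commute)
  show "w \<in> ball z0 R" using box[of w] r by simp
  have "ball w r \<subseteq> ball z0 R" using box ball by blast
  then show "f holomorphic_on ball w r" using hol_f holomorphic_on_subset by blast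
  fix x assume x: "x \<in> ball w r"
  then have "x \<in> ball z0 R" using box ball by blast
  then show "\<bar>Re (f x)\<bar> < M"
    using u_between_sound[of w r "- M" M x] assms ball[OF x] ball_D Re_f
    unfolding u_bounded_def by (simp add: abs_less_iff image_subset_iff)
qed

text \<open>The square puts \<open>x\<close> within \<open>2 * d \<le> r / 2\<close> of
  \<open>w\<close>, so \<open>holomorphic_difference_bound\<close> applies and gives
  \<open>16 = 8 * 2\<close>.\<close>

lemma u_bounded_near:
  assumes "u_bounded g w r M" "\<bar>Re x - Re w\<bar> < d" "\<bar>Im x - Im w\<bar> < d" "4 * d \<le> r"
  shows "\<bar>Im (f x) - Im (f w)\<bar> \<le> 16 * M * d / r"
proof -
  note b = u_bounded_sound[OF assms(1)]
  have M: "M > 0" using b(5)[of w] b(1) by simp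
  have n: "norm (x - w) \<le> 2 * d" using assms(2,3) by (intro norm_le_of_box) auto
  have "\<bar>Im (f x) - Im (f w)\<bar> \<le> norm (f x - f w)" using abs_Im_le_cmod[of "f x - f w"] by simp
  also have "\<dots> \<le> 8 * M * norm (x - w) / r"
    using holomorphic_difference_bound[OF b(4,1,5)] n assms(4) by simp
  also have "\<dots> \<le> 8 * M * (2 * d) / r"
    using n M b(1) by (intro divide_right_mono mult_left_mono) auto
  finally show ?thesis by simp
qed

lemma chain_sound:
  assumes "derivable (chain_rule g) x"
  shows "qdec (p1 (p2 x)) \<le> Im (f (cpt (p1 x))) \<and> Im (f (cpt (p1 x))) \<le> qdec (p2 (p2 x))"
  using assms
proof (rule derivable_induct)
  fix x S
  assume "chain_rule g x S" and IH: "\<And>y. y \<in> S \<Longrightarrow>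
     qdec (p1 (p2 y)) \<le> Im (f (cpt (p1 y))) \<and> Im (f (cpt (p1 y))) \<le> qdec (p2 (p2 y))"
  define w' a' b' where "w' = cpt (p1 x)" "a' = qdec (p1 (p2 x))" "b' = qdec (p2 (p2 x))"
  note defs = w'_a'_b'_def
  from \<open>chain_rule g x S\<close> consider "chain_start g w' a' b'"
    | w a b where "chain_step g w a b w' a' b'" "a \<le> Im (f w)" "Im (f w) \<le> b"
    unfolding chain_rule_def defs using IH by blast
  then have "a' \<le> Im (f w') \<and> Im (f w') \<le> b'"
  proof cases
    case 1
    then obtain r M d where *: "u_bounded g w' r M" "near (centre_name g) w' d" "4 * d \<le> r"
      "a' * r \<le> - (16 * M * d)" "16 * M * d \<le> b' * r"
      unfolding chain_start_def by blast
    have r: "r > 0" using u_bounded_sound(1)[OF *(1)] .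
    have "\<bar>Im (f z0) - Im (f w')\<bar> \<le> 16 * M * d / r"
      using near_sound[OF *(2), of z0] centre_name_iff by (intro u_bounded_near *) auto
    moreover have "a' \<le> - (16 * M * d / r)" "16 * M * d / r \<le> b'"
      using *(4,5) r by (auto simp: field_simps)
    ultimately show ?thesis using Im_f by linarith
  next
    case 2
    then obtain r M e c1 c2 d1 d2 where *: "u_bounded g w r M"
     "(Re w' - Re w) * (Re w' - Re w) + (Im w' - Im w) * (Im w' - Im w) \<le> e * e"
     "0 < e" "4 * e \<le> r" "u_between g w 0 c1 c2"
     "u_between g (Complex (Re w - (Im w' - Im w)) (Im w + (Re w' - Re w))) 0 d1 d2"
     "(a' - a - (c1 - d2)) * (r * r) \<le> - (320 * M * (e * e))"
     "320 * M * (e * e) \<le> (b' - b - (c2 - d1)) * (r * r)"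
      unfolding chain_step_def by blast
    note bd = u_bounded_sound[OF *(1)]
    define h where "h = w' - w"
    have "(norm h)\<^sup>2 \<le> e\<^sup>2" using *(2) unfolding cmod_power2 h_def by (simp add: power2_eq_square)
    then have h: "norm h \<le> e" by (rule power2_le_imp_le) (use *(3) in simp)
    have M: "M > 0" using bd(5)[of w] bd(1) by simp
    have ih: "Complex (Re w - (Im w' - Im w)) (Im w + (Re w' - Re w)) = w + \<i> * h"
      by (simp add: h_def complex_eq_iff)
    have ihB: "w + \<i> * h \<in> ball z0 R"
      using h *(3,4) abs_Re_le_cmod[of h] abs_Im_le_cmod[of h] by (intro bd(2)) auto
    have "c1 < Re (f w) \<and> Re (f w) < c2"
      using u_between_sound[OF *(5), of w] bd(3) ball_D Re_f[OF bd(3)] by (simp add: image_subset_iff)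
    moreover have "d1 < Re (f (w + \<i> * h)) \<and> Re (f (w + \<i> * h)) < d2"
      using u_between_sound[OF *(6)[unfolded ih], of "w + \<i> * h"] ihB ball_D Re_f[OF ihB]
      by (simp add: image_subset_iff)
    \<comment> \<open>The increment of the conjugate is
      \<open>Re (f w) - Re (f (w + \<i> * h))\<close> up to this error, and the enclosures place
      that difference between \<open>c1 - d2\<close> and \<open>c2 - d1\<close>.\<close>
    moreover have "\<bar>(Im (f (w + h)) - Im (f w)) - (Re (f w) - Re (f (w + \<i> * h)))\<bar>
        \<le> 320 * M * (norm h)\<^sup>2 / r\<^sup>2"
      using h *(4) by (intro conjugate_step bd) auto
    moreover have "320 * M * (norm h)\<^sup>2 / r\<^sup>2 \<le> 320 * M * (e * e) / (r * r)"
      using M h *(3) by (auto intro!: divide_right_mono mult_left_mono mult_mono simp: power2_eq_square)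
    moreover have "320 * M * (e * e) / (r * r) \<le> - (a' - a - (c1 - d2))"
      using *(7) unfolding pos_divide_le_eq[OF mult_pos_pos[OF bd(1) bd(1)]] mult_minus_left by linarith
    moreover have "320 * M * (e * e) / (r * r) \<le> b' - b - (c2 - d1)"
      using *(8) unfolding pos_divide_le_eq[OF mult_pos_pos[OF bd(1) bd(1)]] .
    moreover have "w + h = w'" by (simp add: h_def)
    ultimately show ?thesis using 2(2,3) unfolding abs_le_iff by simp
  qed
  then show "qdec (p1 (p2 x)) \<le> Im (f (cpt (p1 x))) \<and> Im (f (cpt (p1 x))) \<le> qdec (p2 (p2 x))"
    by (simp add: defs)
qed

lemma conjugate_in_sound:
  assumes "conjugate_in g n"
  shows "Im (f z) \<in> rbasic n"
proof -
  obtain x r M d where *: "derivable (chain_rule g) x" "u_bounded g (cpt (p1 x)) r M"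
     "near (point_name g) (cpt (p1 x)) d" "4 * d \<le> r"
     "16 * M * d < (qdec (p1 (p2 x)) - qdec (p1 n)) * r"
     "16 * M * d < (qdec (p2 n) - qdec (p2 (p2 x))) * r"
    using assms unfolding conjugate_in_def by blast
  have r: "r > 0" using u_bounded_sound(1)[OF *(2)] .
  have "\<bar>Im (f z) - Im (f (cpt (p1 x)))\<bar> \<le> 16 * M * d / r"
    using near_sound[OF *(3), of z] point_name_iff by (intro u_bounded_near *) auto
  moreover have "16 * M * d / r < qdec (p1 (p2 x)) - qdec (p1 n)"
    "16 * M * d / r < qdec (p2 n) - qdec (p2 (p2 x))"
    using *(5,6) r by (auto simp: pos_divide_less_eq)
  ultimately show ?thesis using chain_sound[OF *(1)] by (auto simp: rbasic_iff)
qed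

end

lemma chain_rule_mono: "chain_rule g x S \<Longrightarrow> S \<subseteq> T \<Longrightarrow> chain_rule g x T"
  unfolding chain_rule_def by blast

lemma chain_derivableI:
  assumes "chain_rule g x S" "finite S" "\<And>s. s \<in> S \<Longrightarrow> derivable (chain_rule g) s"
  shows "derivable (chain_rule g) x"
  by (rule derivableI[OF chain_rule_mono assms])

subsection \<open>Completeness\<close>

context conjugation
begin

lemma D_of_ball: "x \<in> ball z0 R \<Longrightarrow> Some x \<in> D"
  using ball_D by blast

lemma u_between_exact:
  assumes "x \<in> ball z0 R" "\<epsilon> > 0"
  obtains c d where "u_between g x 0 (qdec c) (qdec d)" "qdec d - qdec c < \<epsilon>"
proof -
  obtain c d where cd: "u (Some x) - \<epsilon> / 2 < qdec c" "qdec c < u (Some x)"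
     "u (Some x) < qdec d" "qdec d < u (Some x) + \<epsilon> / 2"
    using qdec_dense[of "u (Some x) - \<epsilon> / 2" "u (Some x)"]
      qdec_dense[of "u (Some x)" "u (Some x) + \<epsilon> / 2"] assms(2) by auto
  have "u_between g x 0 (qdec c) (qdec d)"
    using eventually_nhds_x_imp_x[OF u_between_complete[OF D_of_ball[OF assms(1)] cd(2,3)]] by simp
  then show ?thesis using that cd by force
qed

text \<open>Certificates hold near each \<open>(x, 0)\<close>, and compactness of the segment times
  \<open>{0}\<close> gives one width for all. Thus \<open>r\<close> and \<open>M\<close> are fixed
  before the number of chain points is chosen.\<close>

lemma u_bounded_uniform:
  obtains r M where "0 < qdec r" "0 < qdec M"
    "\<And>x w. x \<in> closed_segment z0 z \<Longrightarrow> norm (w - x) < qdec r \<Longrightarrow> u_bounded g w (qdec r) (qdec M)"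
proof -
  have R: "R > 0" using z by (metis ball_empty empty_iff not_le)
  let ?S = "closed_segment z0 z"
  have sub: "?S \<subseteq> ball z0 R"
    by (rule closed_segment_subset) (use z R in auto)
  have "continuous_on ?S (\<lambda>x. Re (f x))"
    using hol_f sub by (intro continuous_intros) (meson continuous_on_subset holomorphic_on_imp_continuous_on)
  then have "bounded ((\<lambda>x. Re (f x)) ` ?S)" by (intro compact_imp_bounded compact_continuous_image) auto
  then obtain B where B: "\<And>x. x \<in> ?S \<Longrightarrow> \<bar>Re (f x)\<bar> \<le> B" by (auto simp: bounded_iff)
  obtain M where M: "max 0 B < qdec M" using qdec_dense[of "max 0 B" "max 0 B + 1"] by auto
  let ?P = "\<lambda>q. in_disc g (fst q) (snd q) \<and> u_between g (fst q) (snd q) (- qdec M) (qdec M)"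
  have ev: "\<forall>\<^sub>F q in nhds (x, 0). ?P q" if "x \<in> ?S" for x
  proof (rule eventually_conj)
    have xB: "x \<in> ball z0 R" using that sub by blast
    then show "\<forall>\<^sub>F q in nhds (x, 0). in_disc g (fst q) (snd q)" by (rule in_disc_complete)
    have "\<bar>u (Some x)\<bar> < qdec M" using B[OF that] M Re_f[OF xB] by simp
    then show "\<forall>\<^sub>F q in nhds (x, 0). u_between g (fst q) (snd q) (- qdec M) (qdec M)"
      using D_of_ball[OF xB] by (intro u_between_complete) auto
  qed
  define W where "W = interior {q. ?P q}"
  have "?S \<times> {0} \<subseteq> W"
  proof clarify
    fix x assume "x \<in> ?S"
    from ev[OF this] obtain U where U: "open U" "(x, 0) \<in> U" "\<forall>q\<in>U. ?P q"
      unfolding eventually_nhds by blast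
    then have "U \<subseteq> {q. ?P q}" by blast
    with U show "(x, 0) \<in> W" unfolding W_def by (blast intro: interiorI)
  qed
  moreover have "compact (?S \<times> {0 :: real})" by (intro compact_Times) auto
  ultimately obtain e where e: "e > 0" "(\<Union>q\<in>?S \<times> {0}. ball q e) \<subseteq> W"
    using compact_subset_open_imp_ball_epsilon_subset[of "?S \<times> {0}" W] unfolding W_def by auto
  \<comment> \<open>Both coordinates of \<open>(w, qdec r)\<close> may differ from
    \<open>(x, 0)\<close> by \<open>qdec r\<close>, hence \<open>e / 2\<close>.\<close>
  obtain r where r: "0 < qdec r" "qdec r < e / 2" using qdec_dense[of 0 "e / 2"] e(1) by auto
  show ?thesis
  proof (rule that[of r M])
    show "0 < qdec r" "0 < qdec M" using r M by auto
    fix x w assume x: "x \<in> ?S" and w: "norm (w - x) < qdec r"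
    have "dist (x, 0) (w, qdec r) \<le> dist x w + dist 0 (qdec r)"
      unfolding dist_Pair_Pair by (rule sqrt_sum_squares_le_sum) auto
    also have "\<dots> < e" using w r by (simp add: dist_norm norm_minus_commute)
    finally have "(w, qdec r) \<in> ball (x, 0) e" by simp
    then have "(w, qdec r) \<in> W" using e(2) x by blast
    then have "?P (w, qdec r)" unfolding W_def using interior_subset by blast
    then show "u_bounded g w (qdec r) (qdec M)" using r by (simp add: u_bounded_def)
  qed
qed

text \<open>The segment is divided into \<open>N\<close> equal parts and rational points are taken
  near the division points. The first interval has width at most \<open>K0 / N\<close>, and each of
  the \<open>N\<close> steps adds at most \<open>K1 / N^2\<close>, so a large \<open>N\<close>
  brings the total below \<open>gap\<close>.\<close>

lemma conjugate_in_complete: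
  assumes "Im (f z) \<in> rbasic n"
  shows "conjugate_in g n"
proof -
  obtain rc Mc where "0 < qdec rc" "0 < qdec Mc"
    and bd: "\<And>x w. x \<in> closed_segment z0 z \<Longrightarrow> norm (w - x) < qdec rc \<Longrightarrow>
      u_bounded g w (qdec rc) (qdec Mc)"
    using u_bounded_uniform by blast
  define r M where "r = qdec rc" and "M = qdec Mc"
  have r: "r > 0" and M: "M > 0" using \<open>0 < qdec rc\<close> \<open>0 < qdec Mc\<close> by (auto simp: r_def M_def)
  \<comment> \<open>Division points are \<open>(L - 3) / N\<close> apart and are each moved by less
    than \<open>1 / N\<close>. So steps are shorter than \<open>(L - 1) / N\<close>, which leaves
    room for a rational \<open>e\<close> below \<open>L / N\<close>.\<close>
  define L where "L = norm (z - z0) + 3"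
  have L: "L \<ge> 3" by (simp add: L_def)
  \<comment> \<open>\<open>K0 / N\<close> covers twice the starting error
    \<open>16 * M * d / r\<close> with \<open>d < 1 / N\<close> and two roundings by
    \<open>1 / N\<close>. \<open>K1 / N^2\<close> covers two enclosures of \<open>u\<close>, two
    roundings, and twice the error of \<open>conjugate_step\<close>.\<close>
  define K0 K1 where "K0 = 64 * M / r + 2" and "K1 = 4 + 640 * M * L\<^sup>2 / r\<^sup>2"
  define gap where "gap = min (Im (f z) - qdec (p1 n)) (qdec (p2 n) - Im (f z))"
  have gap: "gap > 0" using assms by (auto simp: gap_def rbasic_iff)
  \<comment> \<open>The first condition makes steps shorter than \<open>r / 4\<close>; the second
    makes the accumulated error smaller than the distance of \<open>Im (f z)\<close> from the ends
    of interval \<open>n\<close>.\<close>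
  obtain N :: nat where N: "real N > 4 * L / r" "real N > (K0 + K1 + 64 * M / r) / gap" "N > 0"
  proof -
    obtain N :: nat where "real N > max (4 * L / r) (max ((K0 + K1 + 64 * M / r) / gap) 1)"
      using reals_Archimedean2 by blast
    then show ?thesis by (intro that[of N]) auto
  qed
  have NL: "4 * (L / N) < r" using N(1,3) r by (simp add: field_simps)
  have Ngap: "(K0 + K1 + 64 * M / r) / N < gap" using N(2,3) gap by (simp add: field_simps)
  define x where "x k = z0 + of_real (real k / N) * (z - z0)" for k
  have seg: "z0 + of_real t * (z - z0) = (1 - t) *\<^sub>R z0 + t *\<^sub>R z" for t
    by (simp add: scaleR_conv_of_real algebra_simps)
  have x_seg: "x k \<in> closed_segment z0 z" if "k \<le> N" for k
    unfolding closed_segment_def x_def seg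
    by (intro CollectI exI[of _ "real k / N"]) (use that N(3) in simp)
  have "\<exists>w. \<bar>Re (cpt w) - Re (x k)\<bar> < 1 / (2 * N) \<and> \<bar>Im (cpt w) - Im (x k)\<bar> < 1 / (2 * N)" for k
    using N(3) by (intro cpt_dense) simp
  then obtain W where W: "\<And>k. \<bar>Re (cpt (W k)) - Re (x k)\<bar> < 1 / (2 * N) \<and> \<bar>Im (cpt (W k)) - Im (x k)\<bar> < 1 / (2 * N)"
    by metis
  define w where "w k = cpt (W k)" for k
  have wx: "norm (w k - x k) < 1 / N" for k
  proof -
    have "norm (w k - x k) \<le> \<bar>Re (w k - x k)\<bar> + \<bar>Im (w k - x k)\<bar>" by (rule cmod_le)
    also have "\<dots> < 1 / (2 * N) + 1 / (2 * N)" using W[of k] unfolding w_def minus_complex.sel by linarith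
    also have "\<dots> = 1 / N" by simp
    finally show ?thesis .
  qed
  have "1 / N \<le> L / N" using L by (intro divide_right_mono) auto
  then have oneN: "1 / N < r" using NL r by linarith
  have bdw: "u_bounded g (w k) (qdec rc) (qdec Mc)" if "k \<le> N" for k
    using bd[OF x_seg[OF that]] wx[of k] oneN by (force simp: r_def)
  obtain e where "(L - 1) / N < qdec e" "qdec e < L / N"
    using qdec_dense[of "(L - 1) / N" "L / N"] N(3) by (auto simp: divide_strict_right_mono)
  note e = this
  have e0: "qdec e > 0" using e(1) L N(3) by (smt (verit) divide_nonneg_nonneg of_nat_0_le_iff)
  have step_norm: "norm (w (Suc k) - w k) \<le> qdec e" for k
  proof -
    have "x (Suc k) - x k = of_real (1 / N) * (z - z0)"
      by (simp add: x_def add_divide_distrib algebra_simps)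
    then have "norm (x (Suc k) - x k) = (L - 3) / N" by (simp add: L_def norm_mult norm_divide)
    moreover have "w (Suc k) - w k = (w (Suc k) - x (Suc k)) + (x (Suc k) - x k) - (w k - x k)" by simp
    then have "norm (w (Suc k) - w k) \<le> norm (w (Suc k) - x (Suc k)) + norm (x (Suc k) - x k) + norm (w k - x k)"
      by (metis norm_triangle_ineq norm_triangle_ineq4 add_right_mono order_trans)
    ultimately have "norm (w (Suc k) - w k) \<le> 1 / N + (L - 3) / N + 1 / N" using wx[of k] wx[of "Suc k"] by linarith
    also have "\<dots> = (L - 1) / N" by (simp add: diff_divide_distrib add_divide_distrib)
    finally show ?thesis using e(1) by linarith
  qed
  \<comment> \<open>More than \<open>1 / (2 * N)\<close> certifies that the chain ends are close to
    \<open>z0\<close> and \<open>z\<close>; less than \<open>1 / N\<close> keeps the cost of both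
    links of order \<open>1 / N\<close>.\<close>
  obtain d where d: "1 / (2 * N) < qdec d" "qdec d < 1 / N"
    using qdec_dense[of "1 / (2 * N)" "1 / N"] N(3) by (auto simp: field_simps)
  have d4: "4 * qdec d \<le> r" using d(2) NL \<open>1 / N \<le> L / N\<close> by linarith
  have d0: "qdec d > 0" using d(1) by (smt (verit) divide_nonneg_nonneg of_nat_0_le_iff)
  have Md: "16 * M * qdec d / r \<le> 16 * M / r / N"
    using d(2) M r mult_left_mono[of "qdec d" "1 / N" "16 * M / r"] by (simp add: field_simps)
  have chain: "\<exists>a b. derivable (chain_rule g) (pr (W k) (pr a b)) \<and>
      qdec b - qdec a \<le> K0 / N + k * (K1 / N\<^sup>2)" if "k \<le> N" for k
    using that
  proof (induction k)
    case 0
    let ?t = "16 * M * qdec d / r"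
    obtain a b where ab: "- ?t - 1 / N < qdec a" "qdec a < - ?t" "?t < qdec b" "qdec b < ?t + 1 / N"
      using qdec_dense[of "- ?t - 1 / N" "- ?t"] qdec_dense[of ?t "?t + 1 / N"] N(3) by auto
    have "chain_start g (w 0) (qdec a) (qdec b)"
      unfolding chain_start_def
    proof (intro exI conjI)
      show "u_bounded g (w 0) (qdec rc) (qdec Mc)" by (rule bdw) simp
      show "near (centre_name g) (w 0) (qdec d)"
        using W[of 0] d(1) centre_name_iff
        by (intro near_complete[of z0]) (auto simp: w_def x_def abs_minus_commute)
      show "4 * qdec d \<le> qdec rc" using d4 by (simp add: r_def)
      have "qdec a * r \<le> - ?t * r" using ab(2) r by (intro mult_right_mono) auto
      then show "qdec a * qdec rc \<le> - (16 * qdec Mc * qdec d)" using r by (simp add: r_def[symmetric] M_def[symmetric])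
      have "?t * r \<le> qdec b * r" using ab(3) r by (intro mult_right_mono) auto
      then show "16 * qdec Mc * qdec d \<le> qdec b * qdec rc" using r by (simp add: r_def[symmetric] M_def[symmetric])
    qed
    then have "chain_rule g (pr (W 0) (pr a b)) {}" by (simp add: chain_rule_def w_def)
    then have "derivable (chain_rule g) (pr (W 0) (pr a b))"
      by (rule chain_derivableI) auto
    moreover have "qdec b - qdec a \<le> K0 / N"
    proof -
      have "qdec b - qdec a \<le> 2 * ?t + 2 / N" using ab by simp
      also have "\<dots> \<le> 2 * (16 * M / r / N) + 2 / N" using Md by linarith
      also have "\<dots> \<le> K0 / N" using M r N(3) by (simp add: K0_def add_divide_distrib divide_right_mono)
      finally show ?thesis .
    qed
    ultimately show ?case by auto
  next
    case (Suc k)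
    then obtain a b where ab: "derivable (chain_rule g) (pr (W k) (pr a b))"
      "qdec b - qdec a \<le> K0 / N + k * (K1 / N\<^sup>2)" by auto
    have k: "k \<le> N" using Suc by simp
    note ub = u_bounded_sound[OF bdw[OF k], folded r_def]
    let ?y = "Complex (Re (w k) - (Im (w (Suc k)) - Im (w k))) (Im (w k) + (Re (w (Suc k)) - Re (w k)))"
    have "?y \<in> ball z0 R"
    proof (rule ub(2))
      show "\<bar>Re ?y - Re (w k)\<bar> \<le> r"
        using abs_Im_le_cmod[of "w (Suc k) - w k"] step_norm[of k] e(2) NL e0 by simp
      show "\<bar>Im ?y - Im (w k)\<bar> \<le> r"
        using abs_Re_le_cmod[of "w (Suc k) - w k"] step_norm[of k] e(2) NL e0 by simp
    qed
    have N2: "1 / (real N)\<^sup>2 > 0" using N(3) by simp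
    obtain c1 c2 where c: "u_between g (w k) 0 (qdec c1) (qdec c2)" "qdec c2 - qdec c1 < 1 / N\<^sup>2"
      using u_between_exact[OF ub(3) N2] by auto
    obtain d1 d2 where dd: "u_between g ?y 0 (qdec d1) (qdec d2)" "qdec d2 - qdec d1 < 1 / N\<^sup>2"
      using u_between_exact[OF \<open>?y \<in> ball z0 R\<close> N2] by auto
    let ?t = "320 * M * (qdec e * qdec e) / (r * r)"
    let ?a = "qdec a + (qdec c1 - qdec d2) - ?t" and ?b = "qdec b + (qdec c2 - qdec d1) + ?t"
    obtain a' b' where ab': "?a - 1 / N\<^sup>2 < qdec a'" "qdec a' < ?a" "?b < qdec b'" "qdec b' < ?b + 1 / N\<^sup>2"
      using qdec_dense[of "?a - 1 / N\<^sup>2" ?a] qdec_dense[of ?b "?b + 1 / N\<^sup>2"] N2 by auto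
    have "chain_step g (w k) (qdec a) (qdec b) (w (Suc k)) (qdec a') (qdec b')"
      unfolding chain_step_def
    proof (intro exI conjI)
      show "u_bounded g (w k) (qdec rc) (qdec Mc)" by (rule bdw[OF k])
      have "(norm (w (Suc k) - w k))\<^sup>2 \<le> (qdec e)\<^sup>2" using step_norm[of k] by (intro power_mono) auto
      then show "(Re (w (Suc k)) - Re (w k)) * (Re (w (Suc k)) - Re (w k)) +
          (Im (w (Suc k)) - Im (w k)) * (Im (w (Suc k)) - Im (w k)) \<le> qdec e * qdec e"
        unfolding cmod_power2 by (simp add: power2_eq_square)
      show "0 < qdec e" "4 * qdec e \<le> qdec rc" using e0 e(2) NL by (simp_all add: r_def)
      show "u_between g (w k) 0 (qdec c1) (qdec c2)" "u_between g ?y 0 (qdec d1) (qdec d2)" by fact+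
      have "(qdec a' - qdec a - (qdec c1 - qdec d2)) * (r * r) \<le> (- ?t) * (r * r)"
        using ab'(2) r by (intro mult_right_mono) auto
      then show "(qdec a' - qdec a - (qdec c1 - qdec d2)) * (qdec rc * qdec rc) \<le> - (320 * qdec Mc * (qdec e * qdec e))"
        using r by (simp add: r_def[symmetric] M_def[symmetric])
      have "?t * (r * r) \<le> (qdec b' - qdec b - (qdec c2 - qdec d1)) * (r * r)"
        using ab'(3) r by (intro mult_right_mono) auto
      then show "320 * qdec Mc * (qdec e * qdec e) \<le> (qdec b' - qdec b - (qdec c2 - qdec d1)) * (qdec rc * qdec rc)"
        using r by (simp add: r_def[symmetric] M_def[symmetric])
    qed
    then have "chain_rule g (pr (W (Suc k)) (pr a' b')) {pr (W k) (pr a b)}"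
      by (simp add: chain_rule_def w_def)
    then have "derivable (chain_rule g) (pr (W (Suc k)) (pr a' b'))"
      by (rule chain_derivableI) (use ab(1) in auto)
    moreover have "qdec b' - qdec a' \<le> K0 / N + Suc k * (K1 / N\<^sup>2)"
    proof -
      have "?t \<le> 320 * M * (L / N * (L / N)) / (r * r)"
        using M e(2) e0 by (intro divide_right_mono mult_left_mono mult_mono) auto
      also have "\<dots> = 320 * M * L\<^sup>2 / r\<^sup>2 / N\<^sup>2" by (simp add: power2_eq_square)
      finally have t: "?t \<le> 320 * M * L\<^sup>2 / r\<^sup>2 / N\<^sup>2" .
      have "qdec b' - qdec a' \<le> (qdec b - qdec a) + (qdec c2 - qdec c1) + (qdec d2 - qdec d1) + 2 * ?t + 2 * (1 / N\<^sup>2)"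
        using ab' by simp
      also have "\<dots> \<le> K0 / N + k * (K1 / N\<^sup>2) + 4 * (1 / N\<^sup>2) + 2 * (320 * M * L\<^sup>2 / r\<^sup>2 / N\<^sup>2)"
        using ab(2) c(2) dd(2) t by linarith
      also have "\<dots> = K0 / N + Suc k * (K1 / N\<^sup>2)"
        by (simp add: K1_def algebra_simps add_divide_distrib)
      finally show ?thesis .
    qed
    ultimately show ?case by blast
  qed
  obtain a b where ab: "derivable (chain_rule g) (pr (W N) (pr a b))"
      "qdec b - qdec a \<le> K0 / N + N * (K1 / N\<^sup>2)"
    using chain[of N] by auto
  have "N * (K1 / N\<^sup>2) = K1 / N" using N(3) by (simp add: power2_eq_square)
  then have width: "qdec b - qdec a \<le> (K0 + K1) / N" using ab(2) by (simp add: add_divide_distrib)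
  have near_z: "\<bar>Re z - Re (w N)\<bar> < qdec d" "\<bar>Im z - Im (w N)\<bar> < qdec d"
    using W[of N] d(1) N(3) by (auto simp: x_def w_def abs_minus_commute)
  have "\<bar>Im (f z) - Im (f (w N))\<bar> \<le> 16 * M * qdec d / r"
    using u_bounded_near[OF bdw[OF order_refl] near_z] d4 by (simp add: r_def M_def)
  \<comment> \<open>Soundness locates the derived interval, so its small width puts both ends near
    \<open>Im (f (w N))\<close>. The last link is paid twice: for moving to \<open>z\<close>, and
    for the margin demanded by \<open>conjugate_in\<close>.\<close>
  moreover have "qdec a \<le> Im (f (w N))" "Im (f (w N)) \<le> qdec b"
    using chain_sound[OF ab(1)] by (simp_all add: w_def)
  moreover have "(K0 + K1) / N + 64 * M / r / N < gap" using Ngap by (simp add: add_divide_distrib)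
  moreover have "M / r / N > 0" using M r N(3) by simp
  moreover have "gap \<le> Im (f z) - qdec (p1 n)" "gap \<le> qdec (p2 n) - Im (f z)" by (auto simp: gap_def)
  ultimately have fin: "16 * M * qdec d / r < qdec a - qdec (p1 n)" "16 * M * qdec d / r < qdec (p2 n) - qdec b"
    using width Md unfolding abs_le_iff by linarith+
  show ?thesis
    unfolding conjugate_in_def
  proof (intro exI conjI)
    show "derivable (chain_rule g) (pr (W N) (pr a b))" by (rule ab)
    show "u_bounded g (cpt (p1 (pr (W N) (pr a b)))) (qdec rc) (qdec Mc)"
      using bdw[of N] by (simp add: w_def)
    show "near (point_name g) (cpt (p1 (pr (W N) (pr a b)))) (qdec d)"
      using near_z point_name_iff by (intro near_complete[of z]) (auto simp: w_def)
    show "4 * qdec d \<le> qdec rc" using d4 by (simp add: r_def)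
    show "16 * qdec Mc * qdec d < (qdec (p1 (p2 (pr (W N) (pr a b)))) - qdec (p1 n)) * qdec rc"
      using fin(1) r by (simp add: r_def[symmetric] M_def[symmetric] pos_divide_less_eq)
    show "16 * qdec Mc * qdec d < (qdec (p2 n) - qdec (p2 (p2 (pr (W N) (pr a b))))) * qdec rc"
      using fin(2) r by (simp add: r_def[symmetric] M_def[symmetric] pos_divide_less_eq)
  qed
qed

end

text \<open>The output has the layout required by \<open>fname\<close>: a code at entry 0, then a
  characteristic function. Membership in the graph of \<open>j\<close> is decidable with oracle
  \<open>j\<close>, equality being the vanishing of both truncated differences.\<close>

lemma graph_machine: "\<exists>M. \<forall>j. writes M j
    (\<lambda>n. case n of 0 \<Rightarrow> c | Suc m \<Rightarrow> if j (p1 m) = p2 m then 1 else 0)"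
proof -
  have "rc (\<lambda>j n. if n = 0 then c else
      if (j (p1 (n - 1)) - p2 (n - 1)) + (p2 (n - 1) - j (p1 (n - 1))) = 0 then 1 else 0)"
    by (intro rc_intros)
  also have "(\<lambda>j n. if n = 0 then c else
      if (j (p1 (n - 1)) - p2 (n - 1)) + (p2 (n - 1) - j (p1 (n - 1))) = 0 then 1 else 0)
    = (\<lambda>j n. case n of 0 \<Rightarrow> c | Suc m \<Rightarrow> if j (p1 m) = p2 m then 1 else 0)"
    by (auto simp: fun_eq_iff split: nat.splits)
  finally show ?thesis unfolding rc_def writes_def .
qed

theorem theorem5p1:
  "\<exists>M :: rf. \<forall>(D :: csphere set) (u :: csphere \<Rightarrow> real) pu (z0 :: complex) pz (R :: real) pR.
     domain_cs D \<and> harmonic_cs D u \<and> fname D u pu \<and>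
     cname (Some z0) pz \<and> rname R pR \<and> R > 0 \<and> Some ` cball z0 R \<subseteq> D
     \<longrightarrow> (\<exists>q. writes M (join3 pu pz pR) q \<and>
            (\<exists>v :: csphere \<Rightarrow> real. fname (Some ` ball z0 R) v q \<and>
               harmonic_on (ball z0 R) (\<lambda>z. v (Some z)) \<and>
               (\<lambda>z. complex_of_real (u (Some z)) + \<i> * complex_of_real (v (Some z)))
                  analytic_on ball z0 R))"
proof -
  \<comment> \<open>\<open>E\<close> does not depend on the data, so its code is a constant of the
    machine \<open>M\<close>.\<close>
  obtain E where E: "\<And>g. infinite {n. conjugate_in g n} \<Longrightarrow>
      \<exists>q. writes E g q \<and> range q = {n. conjugate_in g n}"
    using ce_enumerate[OF ce_conjugate_in] by blast
  obtain M where M: "\<And>j. writes M j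
      (\<lambda>n. case n of 0 \<Rightarrow> enc E | Suc m \<Rightarrow> if j (p1 m) = p2 m then 1 else 0)"
    using graph_machine by blast
  show ?thesis
  proof (intro exI[of _ M] allI impI, elim conjE)
    fix D :: "csphere set" and u :: "csphere \<Rightarrow> real" and pu z0 pz R pR
    assume harm: "harmonic_cs D u" and u: "fname D u pu" and z0: "cname (Some z0) pz"
      and R: "rname R pR" "R > 0" and D: "Some ` cball z0 R \<subseteq> D"
    let ?q = "\<lambda>n. case n of 0 \<Rightarrow> enc E | Suc m \<Rightarrow> if join3 pu pz pR (p1 m) = p2 m then 1 else 0"
    let ?X = "{n. join3 pu pz pR (p1 n) = p2 n}"
    have sub: "Some ` ball z0 R \<subseteq> D" using D ball_subset_cball by blast
    have "harmonic_on {z. Some z \<in> D} (\<lambda>z. u (Some z))" using harm by (simp add: harmonic_cs_def)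
    moreover have "ball z0 R \<subseteq> {z. Some z \<in> D}" using sub by blast
    ultimately obtain f where f: "f holomorphic_on ball z0 R"
      "\<And>z. z \<in> ball z0 R \<Longrightarrow> Re (f z) = u (Some z)"
      "harmonic_on (ball z0 R) (\<lambda>z. Im (f z))" "Im (f z0) = 0"
      using harmonic_conjugate_exists[OF _ _ R(2)] by metis
    define v :: "csphere \<Rightarrow> real" where "v s = (case s of None \<Rightarrow> 0 | Some z \<Rightarrow> Im (f z))" for s
    have "realizes E ?X (Some ` ball z0 R) v"
      unfolding realizes_def
    proof (intro ballI allI impI)
      fix s p assume "s \<in> Some ` ball z0 R" and p: "cname s p"
      then obtain z where s: "s = Some z" and zB: "z \<in> ball z0 R" by blast
      obtain e where e: "pu 0 = enc e" "realizes e {n. pu (Suc n) \<noteq> 0} D u"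
        using u unfolding fname_def by blast
      interpret conjugation D u pu pz pR p z0 z R f e "join2 ?X p"
        by unfold_locales (use e z0 R sub s zB p f in auto)
      \<comment> \<open>Soundness and completeness identify the enumerated set with the intervals
        around \<open>v s\<close>; in particular it is infinite, as \<open>E\<close>
        requires.\<close>
      have "{n. conjugate_in (join2 ?X p) n} = {n. v s \<in> rbasic n}"
        using conjugate_in_sound conjugate_in_complete by (auto simp: v_def s)
      then show "\<exists>q. writes E (join2 ?X p) q \<and> rname (v s) q"
        using E[of "join2 ?X p"] infinite_rbasic[of "v s"] unfolding rname_def by auto
    qed
    moreover have "{n. ?q (Suc n) \<noteq> 0} = ?X" by auto
    ultimately have "fname (Some ` ball z0 R) v ?q" unfolding fname_def by (intro exI[of _ E]) simp
    moreover have "harmonic_on (ball z0 R) (\<lambda>z. v (Some z))" using f(3) by (simp add: v_def)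
    moreover have "(\<lambda>z. complex_of_real (u (Some z)) + \<i> * complex_of_real (v (Some z)))
        holomorphic_on ball z0 R"
      by (rule holomorphic_transform[OF f(1)]) (simp add: v_def complex_eq_iff f(2))
    then have "(\<lambda>z. complex_of_real (u (Some z)) + \<i> * complex_of_real (v (Some z)))
        analytic_on ball z0 R" by (simp add: analytic_on_open)
    ultimately show "\<exists>q. writes M (join3 pu pz pR) q \<and>
            (\<exists>v :: csphere \<Rightarrow> real. fname (Some ` ball z0 R) v q \<and>
               harmonic_on (ball z0 R) (\<lambda>z. v (Some z)) \<and>
               (\<lambda>z. complex_of_real (u (Some z)) + \<i> * complex_of_real (v (Some z)))
                  analytic_on ball z0 R)"
      using M[of "join3 pu pz pR"] by blast
  qed
qed

end
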